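(* Let $q \ge 6$ be a positive integer which is not a prime power, and suppose that $q$ satisfies at least one of the following conditions: (1) $q \le 200$ and $q \neq 94, 166$; (2) $q \le 600$ and every prime divisor of $q$ lies in the set $\{2,3,5,7,11\}$. Then there is no perfect $2$-error correcting code with parameters $(n,M)$, $n \ge 5$ and $M \ge 2$, over an alphabet of size $q$.
   Context: Let $q \ge 2$, $e \ge 1$ be integers and let $Z_q$ be a set with $q$ elements (the alphabet). An $e$-error correcting code $C$ with parameters $(n,M)$ is a subset of $Z_q^n$ of size $M$ such that any two distinct elements of $C$ differ in at least $2e+1$ coordinates. Such a code always satisfies $M\sum_{j=0}^{e}\binom{n}{j}(q-1)^j \le q^n$; the code is called perfect if equality holds, i.e. $M\sum_{j=0}^{e}\binom{n}{j}(q-1)^j = q^n$. *)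

theory Defs
  imports "HOL-Library.FuncSet" "HOL-Number_Theory.Number_Theory"
begin

text \<open>Words of length \<open>n\<close> over the alphabet \<open>A\<close> are the functions on \<open>{..<n}\<close> with values in \<open>A\<close>,
  extended by \<open>undefined\<close>, so that \<open>words A n\<close> has exactly \<open>card A ^ n\<close> elements.\<close>

definition words :: "'a set \<Rightarrow> nat \<Rightarrow> (nat \<Rightarrow> 'a) set" where
  "words A n = {..<n} \<rightarrow>\<^sub>E A"

definition hamming_dist :: "nat \<Rightarrow> (nat \<Rightarrow> 'a) \<Rightarrow> (nat \<Rightarrow> 'a) \<Rightarrow> nat" where
  "hamming_dist n x y = card {i. i < n \<and> x i \<noteq> y i}"

definition error_correcting_code ::
  "'a set \<Rightarrow> nat \<Rightarrow> nat \<Rightarrow> nat \<Rightarrow> (nat \<Rightarrow> 'a) set \<Rightarrow> bool" where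
  "error_correcting_code A e n M C \<longleftrightarrow>
     C \<subseteq> words A n \<and> card C = M \<and>
     (\<forall>x\<in>C. \<forall>y\<in>C. x \<noteq> y \<longrightarrow> 2 * e + 1 \<le> hamming_dist n x y)"

definition perfect_code ::
  "'a set \<Rightarrow> nat \<Rightarrow> nat \<Rightarrow> nat \<Rightarrow> (nat \<Rightarrow> 'a) set \<Rightarrow> bool" where
  "perfect_code A e n M C \<longleftrightarrow>
     error_correcting_code A e n M C \<and>
     M * (\<Sum>j=0..e. (n choose j) * (card A - 1) ^ j) = card A ^ n"

end

theory Submission
  imports Defs
begin

text \<open>
  Lloyd's theorem turns a perfect code into two integers. Let \<open>K\<close> map a function \<open>h\<close> on words to the sum of
  \<open>h\<close> over all words arising by rewriting one coordinate. The indicator of a perfect code, corrected by a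
  constant, is annihilated by a quadratic polynomial in \<open>K\<close> but by no linear one, so both roots of that
  polynomial are eigenvalues of \<open>K\<close>, and these are multiples of \<open>q\<close>. Rewriting the roots as \<open>q (n - x)\<close> and
  \<open>q (n - y)\<close> gives \<open>q ((y - x)\<^sup>2 - 1) = 2 (x + y - 3)\<close> and \<open>q - 1\<close> divides \<open>(y - x)\<^sup>2 - 1\<close>, while
  \<open>x y = 2 V / q\<^sup>2\<close>, where the ball size \<open>V\<close> divides \<open>q ^ n\<close>: all primes dividing \<open>x y\<close> divide \<open>2 q\<close>.

  For a fixed \<open>q\<close> this is an exponential equation in the exponents of the primes of \<open>q\<close> in \<open>x\<close> and \<open>y\<close>.
  A common divisor of \<open>x\<close> and \<open>y\<close> divides \<open>q - 6\<close>, so, up to finitely many constant factors, every prime occurs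
  in only one of them; if one of them is bounded, so is the other. The remaining cases have no solution modulo
  suitable small numbers once the exponents are sorted into residue classes. For \<open>q = 6\<close> the bound on common
  divisors is void, but there \<open>2 x\<close> and \<open>2 y\<close> are \<open>d (3 d \<plusminus> 1)\<close> with \<open>d = y - x\<close>.
\<close>

section \<open>Lloyd's theorem for two errors\<close>

definition coord_sum :: "'a set \<Rightarrow> nat \<Rightarrow> ((nat \<Rightarrow> 'a) \<Rightarrow> real) \<Rightarrow> (nat \<Rightarrow> 'a) \<Rightarrow> real" where
  "coord_sum A i h x = (\<Sum>a\<in>A. h (x(i := a)))"

definition coord_sums :: "'a set \<Rightarrow> nat \<Rightarrow> ((nat \<Rightarrow> 'a) \<Rightarrow> real) \<Rightarrow> (nat \<Rightarrow> 'a) \<Rightarrow> real" where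
  "coord_sums A n h x = (\<Sum>i<n. coord_sum A i h x)"

lemma words_upd: "x \<in> words A n \<Longrightarrow> i < n \<Longrightarrow> a \<in> A \<Longrightarrow> x(i := a) \<in> words A n"
  unfolding words_def by (auto simp: PiE_def extensional_def)

lemma finite_words: "finite A \<Longrightarrow> finite (words A n)"
  unfolding words_def by (intro finite_PiE) auto

lemma card_words: "card (words A n) = card A ^ n"
  unfolding words_def by (simp add: card_PiE)

lemma coord_sum_cong:
  assumes "\<And>y. y \<in> words A n \<Longrightarrow> g y = h y" "x \<in> words A n" "i < n"
  shows "coord_sum A i g x = coord_sum A i h x"
  unfolding coord_sum_def using assms by (intro sum.cong refl) (auto intro: words_upd)

lemma coord_sum_commute: "i \<noteq> j \<Longrightarrow> coord_sum A i (coord_sum A j h) x = coord_sum A j (coord_sum A i h) x"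
  unfolding coord_sum_def by (subst sum.swap) (simp add: fun_upd_twist)

lemma coord_sum_idem: "coord_sum A i (coord_sum A i h) x = real (card A) * coord_sum A i h x"
  unfolding coord_sum_def by simp

lemma coord_sum_linear:
  "coord_sum A i (\<lambda>x. g x + h x) x = coord_sum A i g x + coord_sum A i h x"
  "coord_sum A i (\<lambda>x. c * h x) x = c * coord_sum A i h x"
  "coord_sum A i (\<lambda>x. c) x = real (card A) * c"
  unfolding coord_sum_def by (simp_all add: sum.distrib sum_distrib_left)

lemma coord_sums_linear:
  "coord_sums A n (\<lambda>x. g x + h x) x = coord_sums A n g x + coord_sums A n h x"
  "coord_sums A n (\<lambda>x. c * h x) x = c * coord_sums A n h x"
  "coord_sums A n (\<lambda>x. c) x = real (n * card A) * c"
  unfolding coord_sums_def by (simp_all add: coord_sum_linear sum.distrib sum_distrib_left)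

lemma coord_sum_of_sums:
  "j \<ge> m \<Longrightarrow> coord_sum A j (coord_sums A m h) x = coord_sums A m (coord_sum A j h) x"
proof -
  assume j: "j \<ge> m"
  have "coord_sum A j (coord_sums A m h) x = (\<Sum>i<m. coord_sum A j (coord_sum A i h) x)"
    unfolding coord_sum_def[of A j] coord_sums_def by (rule sum.swap)
  also have "\<dots> = (\<Sum>i<m. coord_sum A i (coord_sum A j h) x)"
    using j by (intro sum.cong refl coord_sum_commute) auto
  finally show ?thesis by (simp add: coord_sums_def)
qed

text \<open>Splitting off the last coordinate, whose averaging operator has eigenvalues 0 and \<open>q\<close> only.\<close>

lemma eigenvalue_coord_sums:
  assumes "m \<le> n" "x0 \<in> words A n" "g x0 \<noteq> 0"
    and "\<And>x. x \<in> words A n \<Longrightarrow> coord_sums A m g x = b * g x"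
  shows "\<exists>k\<le>m. b = real (card A * k)"
  using assms
proof (induction m arbitrary: g b x0)
  case 0
  then show ?case using "0.prems"(4)[of x0] by (simp add: coord_sums_def)
next
  case (Suc m)
  define u where "u = coord_sum A m g"
  have split: "coord_sums A (Suc m) f x = coord_sums A m f x + coord_sum A m f x" for f x
    by (simp add: coord_sums_def)
  show ?case
  \<comment> \<open>If \<open>u\<close> is not zero, it is an eigenfunction for the first
    \<open>m\<close> coordinates with eigenvalue \<open>b - card A\<close>. Otherwise the last
    summand kills \<open>g\<close>, which is then itself an eigenfunction for
    \<open>b\<close>.\<close>
  proof (cases "\<exists>x\<in>words A n. u x \<noteq> 0")
    case True
    then obtain x1 where x1: "x1 \<in> words A n" "u x1 \<noteq> 0" by blast
    have "coord_sums A m u x = (b - real (card A)) * u x" if x: "x \<in> words A n" for x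
    proof -
      have "coord_sum A m (coord_sums A (Suc m) g) x = coord_sum A m (\<lambda>x. b * g x) x"
        using Suc.prems x by (intro coord_sum_cong[of A n]) auto
      moreover have "coord_sum A m (coord_sums A (Suc m) g) x
          = coord_sum A m (coord_sums A m g) x + coord_sum A m (coord_sum A m g) x"
        unfolding split coord_sum_linear ..
      ultimately show ?thesis
        by (simp add: coord_sum_of_sums coord_sum_idem coord_sum_linear u_def algebra_simps)
    qed
    from Suc.IH[OF _ x1 this] Suc.prems(1) obtain k where "k \<le> m" "b - real (card A) = real (card A * k)"
      by auto
    then show ?thesis by (intro exI[of _ "Suc k"]) (auto simp: algebra_simps)
  next
    case False
    then have "coord_sums A m g x = b * g x" if "x \<in> words A n" for x
      using Suc.prems(4)[OF that] that by (simp add: split u_def)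
    from Suc.IH[OF _ Suc.prems(2,3) this] Suc.prems(1) show ?thesis
      by (meson Suc_leD le_SucI)
  qed
qed

section \<open>Coordinate sums of indicators of words and balls\<close>

lemma sum_subset_singleton:
  assumes "finite X" "D \<subseteq> X"
  shows "(\<Sum>j\<in>X. of_bool (D \<subseteq> {j})) =
    (if card D = 0 then real (card X) else if card D = 1 then 1 else 0)"
proof -
  have fD: "finite D" using assms finite_subset by blast
  show ?thesis
  proof (cases "card D = 0")
    case True then show ?thesis using fD by simp
  next
    case c0: False
    show ?thesis
    proof (cases "card D = 1")
      case True
      then obtain i where "D = {i}" by (auto simp: card_1_singleton_iff)
      then show ?thesis using assms by (simp add: of_bool_def)
    next
      case False
      have "\<not> D \<subseteq> {j}" for j
      proof
        assume "D \<subseteq> {j}"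
        then have "D = {} \<or> D = {j}" by auto
        then show False using c0 False by auto
      qed
      then show ?thesis using c0 False by simp
    qed
  qed
qed

definition diff_positions :: "nat \<Rightarrow> (nat \<Rightarrow> 'a) \<Rightarrow> (nat \<Rightarrow> 'a) \<Rightarrow> nat set" where
  "diff_positions n x y = {i. i < n \<and> x i \<noteq> y i}"

lemma diff_subset: "diff_positions n x y \<subseteq> {..<n}"
  and finite_diff [simp]: "finite (diff_positions n x y)"
  by (auto simp: diff_positions_def)

lemma hamming_dist_eq: "hamming_dist n x y = card (diff_positions n x y)"
  by (simp add: hamming_dist_def diff_positions_def)

lemma diff_triangle: "card (diff_positions n x y) \<le> card (diff_positions n x z) + card (diff_positions n z y)"
proof -
  have "diff_positions n x y \<subseteq> diff_positions n x z \<union> diff_positions n z y" by (auto simp: diff_positions_def)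
  then show ?thesis
    by (meson card_Un_le card_mono finite_UnI finite_diff le_trans)
qed

lemma diff_commute: "diff_positions n x y = diff_positions n y x"
  by (auto simp: diff_positions_def)

lemma words_eq_iff: "x \<in> words A n \<Longrightarrow> y \<in> words A n \<Longrightarrow> x = y \<longleftrightarrow> diff_positions n x y = {}"
  unfolding words_def diff_positions_def by (auto intro!: ext simp: PiE_def extensional_def) (metis lessThan_iff)

text \<open>Only the letter \<open>c i\<close> can turn \<open>x\<close> into \<open>c\<close>, and
  only if all other coordinates agree already.\<close>

lemma sum_upd_eq:
  assumes "finite A" "x \<in> words A n" "c \<in> words A n" "i < n"
  shows "(\<Sum>a\<in>A. of_bool (x(i := a) = c)) = (of_bool (diff_positions n x c \<subseteq> {i}) :: real)"
proof -
  have "x(i := a) = c \<longleftrightarrow> a = c i \<and> diff_positions n x c \<subseteq> {i}" if "a \<in> A" for a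
    using words_eq_iff[OF words_upd[OF assms(2,4) that] assms(3)] assms(4)
    by (auto simp: diff_positions_def split: if_splits)
  moreover have "c i \<in> A" using assms(3,4) by (auto simp: words_def)
  ultimately show ?thesis using assms(1)
    by (simp add: of_bool_conj sum_distrib_right[symmetric] of_bool_def)
qed

lemma sum_upd_diff:
  assumes "finite A" "c \<in> words A n" "i < n" "i \<noteq> j"
  shows "(\<Sum>a\<in>A. of_bool (diff_positions n (x(i := a)) c \<subseteq> {j})) = (of_bool (diff_positions n x c - {i} \<subseteq> {j}) :: real)"
proof -
  have "diff_positions n (x(i := a)) c \<subseteq> {j} \<longleftrightarrow> a = c i \<and> diff_positions n x c - {i} \<subseteq> {j}" for a
    using assms(3,4) by (auto simp: diff_positions_def split: if_splits)
  moreover have "c i \<in> A" using assms(2,3) by (auto simp: words_def)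
  ultimately show ?thesis using assms(1)
    by (simp add: of_bool_conj sum_distrib_right[symmetric] of_bool_def)
qed

lemma coord_sums_sum: "coord_sums A n (\<lambda>x. \<Sum>c\<in>C. h c x) x = (\<Sum>c\<in>C. coord_sums A n (h c) x)"
proof -
  have "coord_sums A n (\<lambda>x. \<Sum>c\<in>C. h c x) x = (\<Sum>i<n. \<Sum>c\<in>C. coord_sum A i (h c) x)"
    unfolding coord_sums_def coord_sum_def by (intro sum.cong refl sum.swap)
  also have "\<dots> = (\<Sum>c\<in>C. coord_sums A n (h c) x)"
    unfolding coord_sums_def by (rule sum.swap)
  finally show ?thesis .
qed

lemma coord_sums_indicator:
  assumes "finite A" "x \<in> words A n" "c \<in> words A n"
  shows "coord_sums A n (\<lambda>y. of_bool (y = c)) x =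
    (if card (diff_positions n x c) = 0 then real n else if card (diff_positions n x c) = 1 then 1 else 0)"
proof -
  have "coord_sums A n (\<lambda>y. of_bool (y = c)) x = (\<Sum>i<n. of_bool (diff_positions n x c \<subseteq> {i}))"
    unfolding coord_sums_def coord_sum_def using assms by (intro sum.cong refl sum_upd_eq) auto
  also have "\<dots> = (if card (diff_positions n x c) = 0 then real (card {..<n}) else if card (diff_positions n x c) = 1 then 1 else 0)"
    by (rule sum_subset_singleton) (auto simp: diff_subset)
  finally show ?thesis by simp
qed

text \<open>Rewriting \<open>i\<close> and then \<open>j \<noteq> i\<close> can reach
  \<open>c\<close> iff all differences outside \<open>i\<close> lie in \<open>{j}\<close>. The terms
  with \<open>i = j\<close> collapse by idempotence into the summand with
  \<open>card A\<close>.\<close>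

lemma coord_sums_twice_indicator:
  assumes "finite A" "x \<in> words A n" "c \<in> words A n" "n \<ge> 1"
  defines "f \<equiv> \<lambda>y. of_bool (y = c)" and "k \<equiv> card (diff_positions n x c)"
  shows "coord_sums A n (coord_sums A n f) x = real (card A) * coord_sums A n f x +
    (if k = 0 then n * (real n - 1) else if k = 1 then 2 * (real n - 1) else if k = 2 then 2 else 0)"
proof -
  define D where "D = diff_positions n x c"
  have D: "D \<subseteq> {..<n}" "finite D" unfolding D_def using diff_subset by auto
  have kD: "k = card D" by (simp add: k_def D_def)
  have kn: "k \<le> n" unfolding kD using card_mono[OF _ D(1)] by simp
  have inner: "coord_sum A i (coord_sums A n f) x = real (card A) * coord_sum A i f x +
      (if i \<in> D then (if k = 1 then real n - 1 else if k = 2 then 1 else 0)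
       else (if k = 0 then real n - 1 else if k = 1 then 1 else 0))" if i: "i < n" for i
  proof -
    have "coord_sum A i (coord_sums A n f) x = (\<Sum>j<n. coord_sum A i (coord_sum A j f) x)"
      unfolding coord_sum_def[of A i] coord_sums_def by (rule sum.swap)
    also have "\<dots> = coord_sum A i (coord_sum A i f) x + (\<Sum>j\<in>{..<n} - {i}. coord_sum A i (coord_sum A j f) x)"
      using i by (intro sum.remove) auto
    also have "(\<Sum>j\<in>{..<n} - {i}. coord_sum A i (coord_sum A j f) x) =
        (\<Sum>j\<in>{..<n} - {i}. of_bool (D - {i} \<subseteq> {j}))"
    proof (intro sum.cong refl)
      fix j assume j: "j \<in> {..<n} - {i}"
      have "coord_sum A i (coord_sum A j f) x = (\<Sum>a\<in>A. of_bool (diff_positions n (x(i := a)) c \<subseteq> {j}))"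
        unfolding coord_sum_def f_def using i j assms
        by (intro sum.cong refl sum_upd_eq) (auto intro: words_upd)
      also have "\<dots> = of_bool (D - {i} \<subseteq> {j})"
        unfolding D_def using i j assms by (intro sum_upd_diff) auto
      finally show "coord_sum A i (coord_sum A j f) x = of_bool (D - {i} \<subseteq> {j})" .
    qed
    also have "\<dots> = (if card (D - {i}) = 0 then real (card ({..<n} - {i})) else if card (D - {i}) = 1 then 1 else 0)"
      using D(1) by (intro sum_subset_singleton) auto
    also have "real (card ({..<n} - {i})) = real n - 1" using i by (simp add: of_nat_diff)
    finally have eq: "coord_sum A i (coord_sums A n f) x = real (card A) * coord_sum A i f x +
        (if card (D - {i}) = 0 then real n - 1 else if card (D - {i}) = 1 then 1 else 0)"
      by (simp only: coord_sum_idem)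
    show ?thesis
    proof (cases "i \<in> D")
      case True
      then have "card (D - {i}) = k - 1" "k \<ge> 1"
        using D(2) by (auto simp: kD Suc_le_eq card_gt_0_iff)
      then show ?thesis unfolding eq using True by auto
    next
      case False
      then show ?thesis unfolding eq by (simp add: kD)
    qed
  qed
  \<comment> \<open>The inner sum has one value on the \<open>k\<close> positions of difference and
    another on the other \<open>n - k\<close>.\<close>
  define a b where "a = (if k = 1 then real n - 1 else if k = 2 then 1 else 0)"
    and "b = (if k = 0 then real n - 1 else if k = 1 then 1 else 0)"
  have "coord_sums A n (coord_sums A n f) x =
      (\<Sum>i<n. real (card A) * coord_sum A i f x + (if i \<in> D then a else b))"
    unfolding coord_sums_def[of A n "coord_sums A n f"] a_def b_def by (intro sum.cong refl inner) auto
  also have "\<dots> = real (card A) * coord_sums A n f x + (\<Sum>i<n. if i \<in> D then a else b)"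
    by (simp add: sum.distrib sum_distrib_left coord_sums_def)
  also have "(\<Sum>i<n. if i \<in> D then a else b) = k * a + (real n - k) * b"
  proof -
    have "(\<Sum>i<n. if i \<in> D then a else b) = (\<Sum>i\<in>{..<n} \<inter> D. a) + (\<Sum>i\<in>{..<n} \<inter> - D. b)"
      by (subst sum.If_cases) auto
    moreover have "{..<n} \<inter> D = D" using D by auto
    moreover have "card ({..<n} \<inter> - D) = n - k"
      using D by (simp add: kD card_Diff_subset Diff_eq[symmetric])
    ultimately show ?thesis using kn by (simp add: kD of_nat_diff)
  qed
  also have "k * a + (real n - k) * b = (if k = 0 then n * (real n - 1) else if k = 1 then 2 * (real n - 1) else if k = 2 then 2 else 0)"
    by (auto simp: a_def b_def)
  finally show ?thesis .
qed

text \<open>The two coefficients bring the contributions at distances 0 and 1 to the value 2 that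
  distance 2 has anyway. Up to scaling this is the Lloyd polynomial of degree 2, written in the
  operator \<open>coord_sums A n\<close>.\<close>

lemma ball_indicator:
  assumes "finite A" "x \<in> words A n" "c \<in> words A n" "n \<ge> 1"
  defines "f \<equiv> \<lambda>y. of_bool (y = c)"
  shows "coord_sums A n (coord_sums A n f) x - (real (card A) + 2 * real n - 4) * coord_sums A n f x
    + (real n - 1) * (real n - 2) * f x = 2 * of_bool (card (diff_positions n x c) \<le> 2)"
proof -
  define k where "k = card (diff_positions n x c)"
  define K K2 where "K = coord_sums A n f x" and "K2 = coord_sums A n (coord_sums A n f) x"
  have f: "f x = of_bool (k = 0)"
    using words_eq_iff[OF assms(2,3)] by (simp add: f_def k_def)
  have K: "K = (if k = 0 then real n else if k = 1 then 1 else 0)"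
    unfolding K_def f_def k_def by (rule coord_sums_indicator[OF assms(1-3)])
  have K2: "K2 = real (card A) * K +
    (if k = 0 then n * (real n - 1) else if k = 1 then 2 * (real n - 1) else if k = 2 then 2 else 0)"
    unfolding K2_def K_def f_def k_def by (rule coord_sums_twice_indicator[OF assms(1-4)])
  have "K2 - (real (card A) + 2 * real n - 4) * K + (real n - 1) * (real n - 2) * of_bool (k = 0) =
     2 * of_bool (k \<le> 2)"
  proof -
    consider "k = 0" | "k = 1" | "k = 2" | "k > 2" by linarith
    then show ?thesis
    proof cases
      case 1 then show ?thesis unfolding K2 K by (simp add: algebra_simps)
    next
      case 2 then show ?thesis unfolding K2 K by (simp add: algebra_simps)
    next
      case 3 then show ?thesis unfolding K2 K by simp
    next
      case 4 then show ?thesis unfolding K2 K by simp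
    qed
  qed
  then show ?thesis unfolding f K_def K2_def k_def .
qed

section \<open>Perfect codes and the roots of the Lloyd polynomial\<close>

lemma sum_words_coord_sum:
  assumes "finite A" "i < n"
  shows "(\<Sum>x\<in>words A n. coord_sum A i h x) = real (card A) * (\<Sum>x\<in>words A n. h x)"
proof -
  \<comment> \<open>Exchanging the new letter with the overwritten one is an involution on pairs of
    a word and a letter.\<close>
  define \<phi> :: "(nat \<Rightarrow> 'a) \<times> 'a \<Rightarrow> (nat \<Rightarrow> 'a) \<times> 'a" where "\<phi> = (\<lambda>(x, a). (x(i := a), x i))"
  have inv: "\<phi> (\<phi> z) = z" for z
    by (simp add: \<phi>_def case_prod_beta)
  have mem: "\<phi> z \<in> words A n \<times> A" if "z \<in> words A n \<times> A" for z
  proof -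
    obtain x a where z: "z = (x, a)" by fastforce
    have "x i \<in> A" using that assms(2) by (auto simp: z words_def)
    then show ?thesis using that words_upd[of x A n i a] assms(2) by (simp add: z \<phi>_def)
  qed
  have "(\<Sum>x\<in>words A n. coord_sum A i h x) = (\<Sum>z\<in>words A n \<times> A. h (fst (\<phi> z)))"
    unfolding coord_sum_def \<phi>_def by (simp add: sum.cartesian_product case_prod_beta)
  also have "\<dots> = (\<Sum>z\<in>words A n \<times> A. h (fst z))"
    by (rule sum.reindex_bij_witness[of _ \<phi> \<phi>]) (simp_all only: inv mem)
  also have "\<dots> = (\<Sum>x\<in>words A n. \<Sum>a\<in>A. h x)"
    by (simp add: sum.cartesian_product case_prod_beta del: sum_constant)
  finally show ?thesis by (simp add: sum_distrib_left)
qed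

lemma sum_words_coord_sums:
  assumes "finite A"
  shows "(\<Sum>x\<in>words A n. coord_sums A n h x) = real (n * card A) * (\<Sum>x\<in>words A n. h x)"
proof -
  have "(\<Sum>x\<in>words A n. coord_sums A n h x) = (\<Sum>i<n. \<Sum>x\<in>words A n. coord_sum A i h x)"
    unfolding coord_sums_def by (rule sum.swap)
  also have "\<dots> = (\<Sum>i<n. real (card A) * (\<Sum>x\<in>words A n. h x))"
    using assms by (intro sum.cong refl sum_words_coord_sum) auto
  finally show ?thesis by simp
qed

text \<open>The two equations are Vieta's formulas for the roots \<open>q k\<close> and
  \<open>q l\<close> of the quadratic in \<open>ball_indicator\<close>.\<close>

theorem lloyd_two:
  fixes A :: "'a set" and q n :: nat
  assumes A: "finite A" "card A = q" and q: "q \<ge> 2" and n: "n \<ge> 2" and M: "M \<ge> 1"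
    and perfect: "perfect_code A 2 n M C"
  obtains k l :: nat where "k \<le> n" "l \<le> n"
    "real q * (real k + real l) = real q + 2 * real n - 4"
    "real q ^ 2 * real k * real l = (real n - 1) * (real n - 2)"
proof -
  define W where "W = words A n"
  define Q where "Q = real q"
  define N where "N = real n"
  define V where "V = 1 + N * (Q - 1) + N * (N - 1) / 2 * (Q - 1)\<^sup>2"
  define \<sigma> where "\<sigma> = Q + 2 * N - 4"
  define \<pi> where "\<pi> = (N - 1) * (N - 2)"
  define K where "K = coord_sums A n"
  define F where "F = (\<lambda>x. \<Sum>c\<in>C. of_bool (x = c) :: real)"
  define B where "B x = (\<Sum>c\<in>C. of_bool (card (diff_positions n x c) \<le> 2) :: real)" for x
  have QN: "Q \<ge> 2" "N \<ge> 2" using q n by (simp_all add: Q_def N_def)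
  have CW: "C \<subseteq> W" and cC: "card C = M"
    and dist: "\<And>x y. x \<in> C \<Longrightarrow> y \<in> C \<Longrightarrow> x \<noteq> y \<Longrightarrow> 5 \<le> card (diff_positions n x y)"
    and count: "M * (\<Sum>j=0..2. (n choose j) * (q - 1) ^ j) = q ^ n"
    using perfect unfolding perfect_code_def error_correcting_code_def W_def hamming_dist_eq A(2)
    by auto
  have finW: "finite W" unfolding W_def by (rule finite_words[OF A(1)])
  have finC: "finite C" using CW finW finite_subset by blast

  have V: "real M * V = real (card W)"
  proof -
    have "real (\<Sum>j=0..2. (n choose j) * (q - 1) ^ j) = V"
    proof -
      have "(\<Sum>j=0..2. g j) = g 0 + g 1 + g 2" for g :: "nat \<Rightarrow> nat"
        by (simp add: numeral_2_eq_2)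
      then have "(\<Sum>j=0..2. (n choose j) * (q - 1) ^ j) = 1 + n * (q - 1) + (n choose 2) * (q - 1)\<^sup>2"
        by simp
      moreover have "real (n choose 2) = N * (N - 1) / 2"
        using n by (simp add: choose_two N_def real_of_nat_div of_nat_diff)
      moreover have "real (q - 1) = Q - 1"
        using q by (simp add: Q_def of_nat_diff)
      ultimately show ?thesis by (simp add: V_def N_def)
    qed
    then have "real M * V = real (q ^ n)" unfolding count[symmetric] by simp
    then show ?thesis by (simp add: W_def card_words A)
  qed

  have id0: "K (K F) x - \<sigma> * K F x + \<pi> * F x = 2 * B x" if x: "x \<in> W" for x
  proof -
    let ?f = "\<lambda>c y. of_bool (y = c) :: real"
    have KF: "K F y = (\<Sum>c\<in>C. K (?f c) y)" for y
      unfolding K_def F_def by (rule coord_sums_sum)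
    have KKF: "K (K F) x = (\<Sum>c\<in>C. K (K (?f c)) x)"
      unfolding KF[abs_def] by (simp add: K_def coord_sums_sum)
    have "K (K F) x - \<sigma> * K F x + \<pi> * F x =
        (\<Sum>c\<in>C. K (K (?f c)) x - \<sigma> * K (?f c) x + \<pi> * ?f c x)"
      unfolding KKF KF by (simp add: F_def sum.distrib sum_subtractf sum_distrib_left)
    also have "\<dots> = (\<Sum>c\<in>C. 2 * of_bool (card (diff_positions n x c) \<le> 2))"
    proof (rule sum.cong[OF refl])
      fix c assume "c \<in> C"
      then have "c \<in> words A n" using CW by (auto simp: W_def)
      from ball_indicator[OF A(1) _ this, of x] x n
      show "K (K (?f c)) x - \<sigma> * K (?f c) x + \<pi> * ?f c x = 2 * of_bool (card (diff_positions n x c) \<le> 2)"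
        by (simp add: K_def \<sigma>_def \<pi>_def Q_def N_def W_def A)
    qed
    finally show ?thesis by (simp add: B_def sum_distrib_left)
  qed

  have B_le: "B x \<le> 1" if "x \<in> W" for x
  proof -
    have "c = c'" if "c \<in> C" "c' \<in> C" "card (diff_positions n x c) \<le> 2" "card (diff_positions n x c') \<le> 2" for c c'
      using dist[OF that(1,2)] diff_triangle[of n c c' x] that(3,4) diff_commute[of n c x] by force
    then have "card (C \<inter> {c. card (diff_positions n x c) \<le> 2}) \<le> 1"
      using finC by (auto simp: card_le_Suc0_iff_eq)
    then show ?thesis using finC by (simp add: B_def)
  qed

  \<comment> \<open>The quadratic at the eigenvalue \<open>Q * N\<close> of the constants is twice
    the ball size.\<close>
  have eq2V: "(Q * N)\<^sup>2 - \<sigma> * (Q * N) + \<pi> = 2 * V"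
    by (simp add: \<sigma>_def \<pi>_def V_def field_simps power2_eq_square)

  \<comment> \<open>Disjointness of the balls gave \<open>B \<le> 1\<close>; the counting identity
    makes the average of \<open>B\<close> equal to 1, so equality holds at every word.\<close>
  have B1: "B x = 1" if "x \<in> W" for x
  proof -
    have sumF: "(\<Sum>x\<in>W. F x) = real M"
    proof -
      have "(\<Sum>x\<in>W. F x) = (\<Sum>c\<in>C. \<Sum>x\<in>W. of_bool (x = c))"
        unfolding F_def by (rule sum.swap)
      also have "\<dots> = (\<Sum>c\<in>C. 1)"
        using CW finW by (intro sum.cong refl) (auto simp: of_bool_def)
      finally show ?thesis by (simp add: cC)
    qed
    have sumK: "(\<Sum>x\<in>W. K h x) = Q * N * (\<Sum>x\<in>W. h x)" for h
      unfolding K_def W_def by (simp add: sum_words_coord_sums[OF A(1)] A Q_def N_def mult_ac)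
    have "2 * (\<Sum>x\<in>W. B x) = (\<Sum>x\<in>W. K (K F) x - \<sigma> * K F x + \<pi> * F x)"
      by (simp add: id0 sum_distrib_left)
    also have "\<dots> = ((Q * N)\<^sup>2 - \<sigma> * (Q * N) + \<pi>) * real M"
      by (simp add: sum.distrib sum_subtractf sum_distrib_left[symmetric] sumK sumF algebra_simps power2_eq_square)
    also have "\<dots> = 2 * (real M * V)" unfolding eq2V by simp
    finally have "(\<Sum>x\<in>W. 1 - B x) = 0" unfolding V by (simp add: sum_subtractf)
    then have "\<forall>x\<in>W. 1 - B x = 0"
      using B_le by (subst (asm) sum_nonneg_eq_0_iff[OF finW]) auto
    then show ?thesis using that by simp
  qed

  have Kc: "K (\<lambda>x. c) x = Q * N * c" for c x
    unfolding K_def by (simp add: coord_sums_linear A Q_def N_def)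
  have Klin: "K (\<lambda>x. g x - c * h x) x = K g x - c * K h x" for g h c x
    using coord_sums_linear(1)[of A n g "\<lambda>x. (- c) * h x" x] coord_sums_linear(2)[of A n "- c" h x]
    by (simp add: K_def)
  have V0: "V > 0" unfolding V_def using QN by (intro add_pos_nonneg) auto
  \<comment> \<open>The quadratic maps \<open>F\<close> to the constant 2 and a constant
    \<open>c\<close> to \<open>2 V c\<close>, so subtracting \<open>1 / V\<close> yields a function
    which it annihilates.\<close>
  define \<kappa> where "\<kappa> = 1 / V"
  define h where "h x = F x - \<kappa>" for x
  have Kh: "K h x = K F x - Q * N * \<kappa>" for x
    using Klin[of F 1 "\<lambda>x. \<kappa>" x] by (simp add: h_def[abs_def] Kc)
  have KKh: "K (K h) x = K (K F) x - (Q * N)\<^sup>2 * \<kappa>" for x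
    unfolding Kh[abs_def] using Klin[of "K F" 1 "\<lambda>x. Q * N * \<kappa>" x]
    by (simp add: Kc power2_eq_square mult_ac)
  have idh: "K (K h) x - \<sigma> * K h x + \<pi> * h x = 0" if "x \<in> W" for x
  proof -
    have "K (K h) x - \<sigma> * K h x + \<pi> * h x = 2 - ((Q * N)\<^sup>2 - \<sigma> * (Q * N) + \<pi>) * \<kappa>"
      using id0[OF that] B1[OF that] by (simp add: KKh Kh h_def algebra_simps)
    also have "\<dots> = 0" unfolding eq2V \<kappa>_def using V0 by simp
    finally show ?thesis .
  qed

  have KF: "K F x = (\<Sum>c\<in>C. if card (diff_positions n x c) = 0 then N else if card (diff_positions n x c) = 1 then 1 else 0)"
    if "x \<in> W" for x
  proof -
    have "K F x = (\<Sum>c\<in>C. K (\<lambda>y. of_bool (y = c)) x)"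
      unfolding K_def F_def by (rule coord_sums_sum)
    also have "\<dots> = (\<Sum>c\<in>C. if card (diff_positions n x c) = 0 then N else if card (diff_positions n x c) = 1 then 1 else 0)"
      using that CW A(1) unfolding K_def N_def W_def
      by (intro sum.cong refl coord_sums_indicator) auto
    finally show ?thesis .
  qed

  have near: "K F x = (if card (diff_positions n x c) = 0 then N else if card (diff_positions n x c) = 1 then 1 else 0)
      \<and> F x = of_bool (card (diff_positions n x c) = 0)"
    if x: "x \<in> W" and c: "c \<in> C" and le: "card (diff_positions n x c) \<le> 2" for x c
  proof -
    have far: "card (diff_positions n x c') > 2" if c': "c' \<in> C - {c}" for c'
      using dist[OF c, of c'] diff_triangle[of n c c' x] c' le diff_commute[of n c x] by force
    have "x = c \<longleftrightarrow> card (diff_positions n x c) = 0"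
      using words_eq_iff[of x A n c] x c CW by (auto simp: W_def)
    moreover have "x \<noteq> c'" if "c' \<in> C - {c}" for c'
      using far[OF that] by (auto simp: diff_positions_def)
    moreover have "(\<Sum>c'\<in>C - {c}. if card (diff_positions n x c') = 0 then N else if card (diff_positions n x c') = 1 then 1 else 0) = 0"
    proof (intro sum.neutral ballI)
      fix c' assume "c' \<in> C - {c}"
      from far[OF this] show "(if card (diff_positions n x c') = 0 then N else if card (diff_positions n x c') = 1 then 1 else 0) = 0"
        by (cases "diff_positions n x c' = {}") auto
    qed
    then have "K F x = (if card (diff_positions n x c) = 0 then N else if card (diff_positions n x c) = 1 then 1 else 0)"
      unfolding KF[OF x] sum.remove[OF finC c] by simp
    ultimately show ?thesis
      unfolding F_def sum.remove[OF finC c] by simp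
  qed

  obtain c where c: "c \<in> C" using cC M by (metis card.empty ex_in_conv not_one_le_zero)
  have no_eigen: "\<exists>x\<in>W. K h x \<noteq> \<beta> * h x" for \<beta>
  proof (rule ccontr)
    assume "\<not> ?thesis"
    then have eig: "K F x = \<beta> * F x + (Q * N * \<kappa> - \<beta> * \<kappa>)" if "x \<in> W" for x
      using that by (auto simp: Kh h_def algebra_simps)
    have cW: "c \<in> W" using c CW by auto
    have "\<exists>a\<in>A. a \<noteq> c i" for i
    proof (rule ccontr)
      assume "\<not> ?thesis"
      then have "A \<subseteq> {c i}" by auto
      from card_mono[OF _ this] show False using A q by simp
    qed
    then obtain b where b: "\<And>i. b i \<in> A" "\<And>i. b i \<noteq> c i" by metis
    \<comment> \<open>Words at distances 1 and 2 from a codeword: \<open>F\<close> vanishes at both,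
      whereas \<open>K F\<close> takes the values 1 and 0.\<close>
    define x where "x = c(0 := b 0)"
    define y where "y = x(1 := b 1)"
    have xW: "x \<in> W" using words_upd[of c A n 0 "b 0"] cW b n by (simp add: x_def W_def)
    have yW: "y \<in> W" using words_upd[of x A n 1 "b 1"] xW b n by (simp add: y_def W_def)
    have "diff_positions n x c = {0}" "diff_positions n y c = {0, 1}"
      using n b by (auto simp: diff_positions_def x_def y_def)
    then have "K F x = 1" "F x = 0" "K F y = 0" "F y = 0"
      using near[OF xW c] near[OF yW c] by auto
    then show False using eig[OF xW] eig[OF yW] by simp
  qed

  have root: "\<exists>k\<le>n. \<beta> = real (q * k)" if ab: "\<alpha> + \<beta> = \<sigma>" "\<alpha> * \<beta> = \<pi>" for \<alpha> \<beta>
  proof -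
    \<comment> \<open>\<open>(K - \<beta>) (K - \<alpha>) h = 0\<close>, and
      \<open>g = (K - \<alpha>) h\<close> is not zero, so \<open>\<beta>\<close> is an eigenvalue of
      \<open>K\<close>.\<close>
    define g where "g x = K h x - \<alpha> * h x" for x
    obtain x0 where x0: "x0 \<in> W" "g x0 \<noteq> 0" using no_eigen[of \<alpha>] by (auto simp: g_def)
    have "K g x = \<beta> * g x" if "x \<in> W" for x
    proof -
      have g: "g = (\<lambda>x. K h x - \<alpha> * h x)" by (simp add: g_def fun_eq_iff)
      have "K g x = K (K h) x - \<alpha> * K h x" unfolding g by (rule Klin)
      also have "K (K h) x = (\<alpha> + \<beta>) * K h x - \<alpha> * \<beta> * h x"
        using idh[OF that] unfolding ab by simp
      finally show ?thesis by (simp add: g_def[of x] algebra_simps)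
    qed
    then show ?thesis
      using eigenvalue_coord_sums[of n n x0 A g \<beta>] x0 by (auto simp: K_def W_def A)
  qed

  define \<Delta> where "\<Delta> = \<sigma>\<^sup>2 - 4 * \<pi>"
  have "\<Delta> = (Q - 4)\<^sup>2 + 4 * (N * (Q - 1) - 2)"
    by (simp add: \<Delta>_def \<sigma>_def \<pi>_def power2_eq_square algebra_simps)
  moreover have "N * (Q - 1) \<ge> 2 * 1" using QN by (intro mult_mono) auto
  ultimately have "\<Delta> \<ge> 0" by simp
  define \<alpha> where "\<alpha> = (\<sigma> + sqrt \<Delta>) / 2"
  define \<beta> where "\<beta> = (\<sigma> - sqrt \<Delta>) / 2"
  have sum: "\<alpha> + \<beta> = \<sigma>" by (simp add: \<alpha>_def \<beta>_def field_simps)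
  have "\<alpha> * \<beta> = (\<sigma>\<^sup>2 - (sqrt \<Delta>)\<^sup>2) / 4"
    by (simp add: \<alpha>_def \<beta>_def power2_eq_square algebra_simps)
  then have prod: "\<alpha> * \<beta> = \<pi>" using \<open>\<Delta> \<ge> 0\<close> by (simp add: \<Delta>_def)
  from root[OF sum prod] obtain k where k: "k \<le> n" "\<beta> = real (q * k)" by blast
  from root[of \<beta> \<alpha>] sum prod obtain l where l: "l \<le> n" "\<alpha> = real (q * l)"
    by (auto simp: add.commute mult.commute)
  show thesis
    using that[of k l] k l sum prod
    by (simp add: \<sigma>_def \<pi>_def Q_def N_def algebra_simps power2_eq_square)
qed

section \<open>The two roots as a pair of integers, with the length eliminated\<close>

definition root_pair :: "int \<Rightarrow> int \<Rightarrow> int \<Rightarrow> bool" where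
  "root_pair q x y \<longleftrightarrow>
     q * ((y - x)\<^sup>2 - 1) = 2 * (x + y - 3) \<and> (q - 1) dvd ((y - x)\<^sup>2 - 1) \<and> (y - x)\<^sup>2 > 1"

lemma root_pair_commute: "root_pair q x y \<longleftrightarrow> root_pair q y x"
  unfolding root_pair_def by (simp add: add.commute power2_commute[of x y])

lemma perfect_code_root_pair:
  fixes A :: "'a set" and q n :: nat
  assumes A: "finite A" "card A = q" and q: "q \<ge> 2" and n: "n \<ge> 3" and M: "M \<ge> 1"
    and perfect: "perfect_code A 2 n M C"
  obtains x y :: int where "x > 0" "y > 0" "root_pair (int q) x y"
    "int q ^ 2 * (x * y) * int M = 2 * int q ^ n"
proof -
  obtain k l where kl: "k \<le> n" "l \<le> n"
    and sum_real: "real q * (real k + real l) = real q + 2 * real n - 4"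
    and prod_real: "real q ^ 2 * real k * real l = (real n - 1) * (real n - 2)"
    using lloyd_two[OF A q _ M perfect] n by auto
  define Q N K L where "Q = int q" "N = int n" "K = int k" "L = int l"
  note defs = Q_N_K_L_def
  have sum: "Q * (K + L) = Q + 2 * N - 4"
  proof -
    have "real_of_int (Q * (K + L)) = real_of_int (Q + 2 * N - 4)"
      using sum_real by (simp add: defs)
    then show ?thesis by linarith
  qed
  have prod: "Q\<^sup>2 * (K * L) = (N - 1) * (N - 2)"
  proof -
    have "real_of_int (Q\<^sup>2 * (K * L)) = real_of_int ((N - 1) * (N - 2))"
      using prod_real by (simp add: defs mult_ac)
    then show ?thesis by (simp only: of_int_eq_iff)
  qed
  \<comment> \<open>These are the zeros of the Lloyd polynomial in its usual variable, the weight: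
    on characters of weight \<open>w\<close> the operator of coordinate sums has the eigenvalue
    \<open>q (n - w)\<close>.\<close>
  define x y where "x = N - K" "y = N - L"
  have xy: "x = N - K" "y = N - L" by (simp_all add: x_y_def)
  have QN: "Q \<ge> 2" "N \<ge> 3" using q n by (simp_all add: defs)
  \<comment> \<open>\<open>D\<close> comes from the discriminant and \<open>S\<close> from the sum
    of the roots. Both contain the factor \<open>(Q - 1) * (N - 2)\<close>, whose elimination
    removes the length.\<close>
  have D: "Q\<^sup>2 * ((y - x)\<^sup>2 - 1) = 4 * (Q - 1) * (N - 2)"
  proof -
    have "Q\<^sup>2 * ((y - x)\<^sup>2 - 1) = (Q * (K + L))\<^sup>2 - 4 * (Q\<^sup>2 * (K * L)) - Q\<^sup>2"
      by (simp add: xy power2_eq_square algebra_simps)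
    also have "\<dots> = 4 * (Q - 1) * (N - 2)"
      unfolding sum prod by (simp add: power2_eq_square algebra_simps)
    finally show ?thesis .
  qed
  have S: "Q * (x + y - 3) = 2 * (Q - 1) * (N - 2)"
  proof -
    have "Q * (x + y - 3) = 2 * N * Q - Q * (K + L) - 3 * Q" by (simp add: xy algebra_simps)
    also have "\<dots> = 2 * (Q - 1) * (N - 2)" unfolding sum by (simp add: algebra_simps)
    finally show ?thesis .
  qed
  have "Q * (Q * ((y - x)\<^sup>2 - 1)) = Q * (2 * (x + y - 3))"
    using D S by (simp add: power2_eq_square algebra_simps)
  then have "Q * ((y - x)\<^sup>2 - 1) = 2 * (x + y - 3)" using QN by simp
  moreover have "(Q - 1) dvd ((y - x)\<^sup>2 - 1)"
  proof -
    have "coprime (Q - 1) (Q\<^sup>2)"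
      using coprime_diff_one_left[of Q] by simp
    moreover have "(Q - 1) dvd Q\<^sup>2 * ((y - x)\<^sup>2 - 1)"
      unfolding D by (intro dvd_mult2 dvd_triv_right)
    ultimately show ?thesis by (simp add: coprime_dvd_mult_right_iff)
  qed
  \<comment> \<open>Here \<open>n \<ge> 3\<close> enters. The condition removes the pair 1, 2, which
    satisfies the other two conditions for every alphabet size.\<close>
  moreover have "(y - x)\<^sup>2 > 1"
  proof -
    have "Q\<^sup>2 * ((y - x)\<^sup>2 - 1) > 0" unfolding D using QN by simp
    then show ?thesis using QN by (simp add: zero_less_mult_iff)
  qed
  ultimately have rp: "root_pair Q x y" by (simp add: root_pair_def)
  have two_V: "Q\<^sup>2 * (x * y) = 2 + 2 * (N * (Q - 1)) + N * (N - 1) * (Q - 1)\<^sup>2"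
  proof -
    have "Q\<^sup>2 * (x * y) = Q\<^sup>2 * N\<^sup>2 - Q * N * (Q * (K + L)) + Q\<^sup>2 * (K * L)"
      by (simp add: xy power2_eq_square algebra_simps)
    also have "\<dots> = 2 + 2 * (N * (Q - 1)) + N * (N - 1) * (Q - 1)\<^sup>2"
      unfolding sum prod by (simp add: power2_eq_square algebra_simps)
    finally show ?thesis .
  qed
  define W where "W = int (n choose 2)"
  have "int M * (1 + int n * int (q - 1) + int (n choose 2) * (int (q - 1))\<^sup>2) = int q ^ n"
  proof -
    have "M * (\<Sum>j=0..2. (n choose j) * (q - 1) ^ j) = q ^ n"
      using perfect A by (simp add: perfect_code_def)
    moreover have "(\<Sum>j=0..2. g j) = g 0 + g 1 + g 2" for g :: "nat \<Rightarrow> nat"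
      by (simp add: numeral_2_eq_2)
    ultimately have "M * (1 + n * (q - 1) + (n choose 2) * (q - 1)\<^sup>2) = q ^ n"
      by simp
    from arg_cong[OF this, of int] show ?thesis by (simp only: of_nat_mult of_nat_add of_nat_power of_nat_1)
  qed
  moreover have "int (q - 1) = Q - 1" using q by (simp add: defs of_nat_diff)
  ultimately have count: "int M * (1 + N * (Q - 1) + W * (Q - 1)\<^sup>2) = Q ^ n"
    by (simp add: defs W_def)
  have W: "2 * W = N * (N - 1)"
  proof -
    have "even (n * (n - 1))" by auto
    then have "2 * (n choose 2) = n * (n - 1)" by (simp add: choose_two)
    from arg_cong[OF this, of int] show ?thesis using n by (simp add: defs W_def of_nat_diff)
  qed
  have MV: "Q\<^sup>2 * (x * y) * int M = 2 * Q ^ n"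
    unfolding two_V count[symmetric] W[symmetric] by (simp add: algebra_simps)
  have "x * y \<noteq> 0" using MV QN by auto
  moreover have "x \<ge> 0" "y \<ge> 0" using kl by (simp_all add: xy defs)
  ultimately have "x > 0" "y > 0" by (auto simp: order_less_le)
  then show thesis using that rp MV by (simp add: defs)
qed

section \<open>Sieving the exponents\<close>

text \<open>
  The functions of this section are evaluated by the simplifier, which traverses the result of every \<open>if\<close> and
  \<open>case\<close> once more from scratch. The code equations therefore branch by pattern matching on an evaluated
  condition, in auxiliary functions with a prime.
\<close>

subsection \<open>Residues\<close>

definition fit :: "int \<Rightarrow> int \<Rightarrow> int" where
  [code del]: "fit m r = (if r < m then r else r - m)"
definition [code del]: "fit' b m r = (if b then r else r - m)" for r :: int

lemma fit_code [code]:
  "fit m r = fit' (r < m) m r"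
  "fit' True m r = r"
  "fit' False m r = r - m"
  by (simp_all add: fit_def fit'_def)

lemma fit_eq_mod: "0 \<le> r \<Longrightarrow> r < 2 * m \<Longrightarrow> fit m r = r mod m"
  using mod_pos_pos_trivial[of "r - m" m] by (simp add: fit_def)

text \<open>Horner's scheme on the binary digits: every intermediate value is below
  \<open>2 * m\<close>, so a comparison and a subtraction replace the division.\<close>

primrec reduce :: "int \<Rightarrow> num \<Rightarrow> int" where
  "reduce m num.One = fit m 1"
| "reduce m (num.Bit0 n) = fit m (Int.dup (reduce m n))"
| "reduce m (num.Bit1 n) = fit m (Int.dup (reduce m n) + 1)"

lemma reduce_eq_mod: "m > 0 \<Longrightarrow> reduce m n = numeral n mod m"
proof (induction n)
  case One then show ?case by (simp add: fit_eq_mod)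
next
  case (Bit0 n)
  have "2 * (numeral n mod m) mod m = numeral (num.Bit0 n) mod m"
    by (metis mod_mult_right_eq mult_2 numeral_Bit0)
  then show ?case using Bit0 pos_mod_bound[of m "numeral n"] by (simp add: Int.dup_def fit_eq_mod)
next
  case (Bit1 n)
  have "(2 * (numeral n mod m) + 1) mod m = numeral (num.Bit1 n) mod m"
    by (metis mod_add_left_eq mod_mult_right_eq mult_2 numeral_Bit1)
  moreover have "fit m (2 * (numeral n mod m) + 1) = (2 * (numeral n mod m) + 1) mod m"
    using Bit1(2) pos_mod_bound[of m "numeral n"] pos_mod_sign[of m "numeral n"]
    by (intro fit_eq_mod) linarith+
  ultimately show ?case using Bit1 by (simp add: Int.dup_def)
qed

definition residue :: "int \<Rightarrow> int \<Rightarrow> int" where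
  [code del]: "residue m x = (if x > 0 then reduce m (num_of_nat (nat x)) else x mod m)"

lemma residue_code [code]:
  "residue m 0 = 0"
  "residue m (Int.Pos n) = reduce m n"
  "residue m (Int.Neg n) = Int.Neg n mod m"
  by (simp_all add: residue_def)

lemma numeral_num_of_nat_nat: "x > 0 \<Longrightarrow> numeral (num_of_nat (nat x)) = x"
  by (metis int_nat_eq less_imp_le numeral_num_of_nat of_nat_numeral zero_less_nat_eq)

lemma residue_eq_mod: "m > 0 \<Longrightarrow> residue m x = x mod m"
  by (simp add: residue_def reduce_eq_mod numeral_num_of_nat_nat)

subsection \<open>Powers\<close>

primrec squarings :: "int \<Rightarrow> nat \<Rightarrow> int \<Rightarrow> int list" where
  "squarings m 0 b = []"
| "squarings m (Suc k) b = residue m (b * b) # squarings m k (residue m (b * b))"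

text \<open>Square and multiply, where the squares are read from the list as long as it lasts and
  computed afterwards.\<close>

fun power_by :: "int \<Rightarrow> int \<Rightarrow> int list \<Rightarrow> num \<Rightarrow> int" where
  "power_by m b bs num.One = b"
| "power_by m b [] (num.Bit0 n) = power_by m (residue m (b * b)) [] n"
| "power_by m b (x # xs) (num.Bit0 n) = power_by m x xs n"
| "power_by m b [] (num.Bit1 n) = residue m (b * power_by m (residue m (b * b)) [] n)"
| "power_by m b (x # xs) (num.Bit1 n) = residue m (b * power_by m x xs n)"

fun squares :: "int \<Rightarrow> int \<Rightarrow> int list \<Rightarrow> bool" where
  "squares m b [] = True"
| "squares m b (x # xs) = ([x = b * b] (mod m) \<and> squares m x xs)"

lemma cong_residue: "m > 0 \<Longrightarrow> [residue m x = x] (mod m)"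
  by (simp add: residue_eq_mod cong_def)

lemma squares_squarings: "m > 0 \<Longrightarrow> squares m b (squarings m k b)"
  by (induction k arbitrary: b) (simp_all add: cong_residue)

lemma power_by_cong: "m > 0 \<Longrightarrow> squares m b bs \<Longrightarrow> [power_by m b bs n = b ^ numeral n] (mod m)"
proof (induction m b bs n rule: power_by.induct)
  case (2 m b n)
  have "[residue m (b * b) ^ numeral n = (b * b) ^ numeral n] (mod m)"
    using 2 by (intro cong_pow cong_residue)
  then show ?case using 2
    by (auto simp: numeral_Bit0 power_add power_mult_distrib intro: cong_trans)
next
  case (3 m b x xs n)
  have "[x ^ numeral n = (b * b) ^ numeral n] (mod m)"
    using 3 by (intro cong_pow) auto
  then show ?case using 3
    by (auto simp: numeral_Bit0 power_add power_mult_distrib intro: cong_trans)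
next
  case (4 m b n)
  have "[residue m (b * b) ^ numeral n = (b * b) ^ numeral n] (mod m)"
    using 4 by (intro cong_pow cong_residue)
  with 4 have "[power_by m (residue m (b * b)) [] n = (b * b) ^ numeral n] (mod m)"
    by (auto intro: cong_trans)
  then have "[b * power_by m (residue m (b * b)) [] n = b * (b * b) ^ numeral n] (mod m)"
    by (rule cong_scalar_left)
  moreover have "b * (b * b) ^ numeral n = b ^ numeral (num.Bit1 n)"
    unfolding numeral_Bit1 power_add power_mult_distrib by simp
  ultimately show ?case using cong_residue[OF 4(2)] by (auto intro: cong_trans)
next
  case (5 m b x xs n)
  have "[x ^ numeral n = (b * b) ^ numeral n] (mod m)"
    using 5 by (intro cong_pow) auto
  with 5 have "[power_by m x xs n = (b * b) ^ numeral n] (mod m)"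
    by (auto intro: cong_trans)
  then have "[b * power_by m x xs n = b * (b * b) ^ numeral n] (mod m)"
    by (rule cong_scalar_left)
  moreover have "b * (b * b) ^ numeral n = b ^ numeral (num.Bit1 n)"
    unfolding numeral_Bit1 power_add power_mult_distrib by simp
  ultimately show ?case using cong_residue[OF 5(2)] by (auto intro: cong_trans)
qed simp

definition powers :: "int \<Rightarrow> int \<times> int list \<Rightarrow> int \<Rightarrow> int" where
  [code del]: "powers m b e = (if e > 0 then power_by m (fst b) (snd b) (num_of_nat (nat e)) else 1)"

lemma powers_code [code]:
  "powers m a 0 = 1"
  "powers m (b, bs) (Int.Pos n) = power_by m b bs n"
  "powers m a (Int.Neg n) = 1"
  by (simp_all add: powers_def)

primrec base_table :: "nat \<Rightarrow> int \<Rightarrow> int list \<Rightarrow> (int \<times> int \<times> int list) list" where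
  "base_table k m [] = []"
| "base_table k m (p # ps) =
     (p, residue m p, squarings m k (residue m p)) # base_table k m ps"

text \<open>A base missing from the table stands for itself without stored squares, so the lookup is
  sound for every base.\<close>

primrec base :: "int \<Rightarrow> (int \<times> int \<times> int list) list \<Rightarrow> int \<times> int list" where
  "base p [] = (p, [])"
| "base p (a # r) = (if fst a = p then snd a else base p r)"

definition [code del]: "base' b x p r = (if b then x else base p r)"

lemma base_code [code]:
  "base p [] = (p, [])"
  "base p ((p', x) # r) = base' (p' = p) x p r"
  "base' True x p r = x"
  "base' False x p r = base p r"
  by (simp_all add: base'_def)

lemma powers_base:
  assumes "m > 0"
  shows "[powers m (base p (base_table k m ps)) e = p ^ nat e] (mod m)"
proof -
  have *: "[fst (base p (base_table k m ps)) = p] (mod m) \<and>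
      squares m (fst (base p (base_table k m ps))) (snd (base p (base_table k m ps)))"
    using assms by (induction ps) (auto simp: cong_residue squares_squarings)
  show ?thesis
  proof (cases "e > 0")
    case True
    then have "numeral (num_of_nat (nat e)) = nat e" by (simp add: numeral_num_of_nat)
    then show ?thesis
      using power_by_cong[OF assms, of "fst (base p (base_table k m ps))" "snd (base p (base_table k m ps))" "num_of_nat (nat e)"]
        cong_pow[of "fst (base p (base_table k m ps))" p m "nat e"] * True
      by (auto simp: powers_def intro: cong_trans)
  qed (simp add: powers_def)
qed

subsection \<open>One stage of the sieve\<close>

type_synonym progression = "int \<times> int \<times> int"
type_synonym state = "int \<times> progression list \<times> int \<times> progression list"

text \<open>A progression records that an exponent is at least \<open>e\<close> and congruent to
  \<open>e\<close> modulo \<open>L\<close>. Refining it replaces \<open>L\<close> by a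
  multiple.\<close>

primrec covers :: "progression list \<Rightarrow> int \<Rightarrow> bool" where
  "covers [] x \<longleftrightarrow> x = 1"
| "covers (g # gs) x \<longleftrightarrow> (case g of (p, e, L) \<Rightarrow> 0 \<le> e \<and> 0 \<le> L \<and>
     (\<exists>t y. covers gs y \<and> x = p ^ (nat e + nat L * t) * y))"

definition covers_pair :: "state \<Rightarrow> int \<Rightarrow> int \<Rightarrow> bool" where
  "covers_pair = (\<lambda>(c, gs, d, hs) x y. \<exists>u v. covers gs u \<and> covers hs v \<and> x = c * u \<and> y = d * v)"

text \<open>Walks through the residues of the powers until \<open>x\<close> recurs and returns the
  exponent of the recurrence with the classes met. The empty list signals failure: the fuel is
  spent, or 0 was reached, after which \<open>x\<close> cannot recur.\<close>

primrec orbit_from :: "nat \<Rightarrow> int \<Rightarrow> int \<Rightarrow> int \<Rightarrow> int \<Rightarrow> int \<Rightarrow> int \<Rightarrow> (int \<times> int) list \<Rightarrow> int \<times> (int \<times> int) list"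
where
  "orbit_from 0 m w x e L z acc = (0, [])"
| "orbit_from (Suc k) m w x e L z acc = (if z = x then (e, acc) else if z = 0 then (0, [])
     else orbit_from k m w x (e + L) L (residue m (z * w)) ((z, e) # acc))"

definition [code del]: "orbit_from' b b' k m w x e L z acc = (if b then (e, acc) else if b' then (0, [])
     else orbit_from k m w x (e + L) L (residue m (z * w)) ((z, e) # acc))"

lemma orbit_from_code [code]:
  "orbit_from 0 m w x e L z acc = (0, [])"
  "orbit_from (Suc k) m w x e L z acc = orbit_from' (z = x) (z = 0) k m w x e L z acc"
  "orbit_from' True b k m w x e L z acc = (e, acc)"
  "orbit_from' False True k m w x e L z acc = (0, [])"
  "orbit_from' False False k m w x e L z acc = orbit_from k m w x (e + L) L (residue m (z * w)) ((z, e) # acc)"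
  by (simp_all add: orbit_from'_def)

text \<open>The walk begins one step after \<open>x\<close>, so that the start is not taken for a
  return. A power that is already 0 modulo \<open>m\<close> has period 1.\<close>

definition orbit :: "nat \<Rightarrow> int \<Rightarrow> int \<Rightarrow> int \<Rightarrow> int \<Rightarrow> int \<Rightarrow> int \<times> (int \<times> int) list" where
  "orbit F m x w e L = orbit_from F m w x (e + L) L (residue m (x * w)) [(x, e)]"

definition lists_powers :: "int \<Rightarrow> int \<Rightarrow> nat \<Rightarrow> nat \<Rightarrow> nat \<Rightarrow> (int \<times> int) list \<Rightarrow> bool" where
  "lists_powers m p e l J ys \<longleftrightarrow>
     (\<forall>j<J. \<exists>y. (y, int (e + l * j)) \<in> set ys \<and> [y = p ^ (e + l * j)] (mod m))"

lemma orbit_from_powers: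
  assumes "m > 0" "[w = p ^ l] (mod m)"
    and "orbit_from k m w x (int (e + l * J)) (int l) z acc = (n, ys)" "ys \<noteq> []"
    and "[z = p ^ (e + l * J)] (mod m)" "J > 0" "lists_powers m p e l J acc"
  shows "\<exists>J>0. n = int (e + l * J) \<and> [x = p ^ (e + l * J)] (mod m) \<and> lists_powers m p e l J ys"
  using assms(3-)
proof (induction k arbitrary: J z acc)
  case (Suc k)
  show ?case
  proof (cases "z = x \<or> z = 0")
    case True
    then show ?thesis using Suc.prems by (auto split: if_splits)
  next
    case False
    have "[z * w = p ^ (e + l * J) * p ^ l] (mod m)"
      using Suc.prems(3) assms(2) by (rule cong_mult)
    then have "[residue m (z * w) = p ^ (e + l * Suc J)] (mod m)"
      using cong_residue[OF assms(1), of "z * w"]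
      by (auto simp: power_add[symmetric] algebra_simps intro: cong_trans)
    moreover have "lists_powers m p e l (Suc J) ((z, int (e + l * J)) # acc)"
      using Suc.prems(3,5) unfolding lists_powers_def by (auto simp: less_Suc_eq)
    moreover have "orbit_from k m w x (int (e + l * Suc J)) (int l) (residue m (z * w))
        ((z, int (e + l * J)) # acc) = (n, ys)"
      using Suc.prems(1) False by (simp add: algebra_simps)
    ultimately show ?thesis using Suc.IH[of "Suc J"] Suc.prems(2) by blast
  qed
qed simp

lemma power_periodic:
  fixes p m :: int
  assumes "[p ^ (e + l * J) = p ^ e] (mod m)"
  shows "[p ^ (e + l * (J * t + r)) = p ^ (e + l * r)] (mod m)"
proof (induction t)
  case (Suc t)
  have "e + l * (J * Suc t + r) = (e + l * J) + (l * (J * t) + l * r)"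
    "e + l * (J * t + r) = e + (l * (J * t) + l * r)" by (simp_all add: algebra_simps)
  then have "[p ^ (e + l * (J * Suc t + r)) = p ^ (e + l * (J * t + r))] (mod m)"
    using cong_scalar_right[OF assms] by (simp only: power_add)
  with Suc show ?case by (rule cong_trans[rotated])
qed simp

text \<open>The index \<open>t\<close> may be reduced modulo the number \<open>J\<close> of steps in
  the period; the class of \<open>t mod J\<close> is listed and continues with step
  \<open>l * J\<close>.\<close>

lemma orbit_powers:
  assumes m: "m > 0" and "[x = p ^ e] (mod m)" "[w = p ^ l] (mod m)"
    and orb: "orbit F m x w (int e) (int l) = (n, ys)" "ys \<noteq> []"
  obtains y e' L' t' where "(y, int e') \<in> set ys" "n - int e = int L'"
    "e + l * t = e' + L' * t'" "[y = p ^ (e + l * t)] (mod m)"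
proof -
  have "[residue m (x * w) = p ^ (e + l * 1)] (mod m)"
    using cong_residue[OF m, of "x * w"] cong_mult[OF assms(2,3)]
    by (auto simp: power_add intro: cong_trans)
  moreover have "lists_powers m p e l 1 [(x, int e)]"
    using assms(2) by (simp add: lists_powers_def)
  ultimately obtain J where J: "J > 0" "n = int (e + l * J)" "[x = p ^ (e + l * J)] (mod m)"
      "lists_powers m p e l J ys"
    using orbit_from_powers[OF m assms(3), of F x e 1 "residue m (x * w)" "[(x, int e)]" n ys] orb
    by (auto simp: orbit_def)
  have t: "t = J * (t div J) + t mod J" by simp
  have "[p ^ (e + l * J) = p ^ e] (mod m)"
    using J(3) assms(2) by (meson cong_sym cong_trans)
  from power_periodic[OF this, of "t div J" "t mod J"]
  have per: "[p ^ (e + l * t) = p ^ (e + l * (t mod J))] (mod m)" unfolding t[symmetric] .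
  from J(1,4) obtain y where y: "(y, int (e + l * (t mod J))) \<in> set ys"
      "[y = p ^ (e + l * (t mod J))] (mod m)"
    unfolding lists_powers_def using mod_less_divisor by blast
  have "e + l * t = (e + l * (t mod J)) + l * J * (t div J)"
    using arg_cong[OF t, of "\<lambda>s. l * s"] by (simp only: distrib_left mult.assoc add_ac)
  then show thesis
    using that[OF y(1), of "l * J" "t div J"] J(2) y(2) per by (auto intro: cong_trans cong_sym)
qed

fun attach :: "int \<Rightarrow> int \<Rightarrow> progression \<Rightarrow> (int \<times> progression list) list
  \<Rightarrow> (int \<times> progression list) list \<Rightarrow> (int \<times> progression list) list" where
  "attach m y g [] rest = rest"
| "attach m y g ((v, gs) # R) rest = (residue m (v * y), g # gs) # attach m y g R rest"

fun attach_all :: "int \<Rightarrow> int \<Rightarrow> int \<Rightarrow> (int \<times> progression list) list \<Rightarrow> (int \<times> int) list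
  \<Rightarrow> (int \<times> progression list) list" where
  "attach_all m p L R [] = []"
| "attach_all m p L R ((y, e) # ys) = attach m y (p, e, L) R (attach_all m p L R ys)"

lemma set_attach:
  "set (attach m y g R rest) = (\<lambda>(v, gs). (residue m (v * y), g # gs)) ` set R \<union> set rest"
  by (induction m y g R rest rule: attach.induct) auto

lemma attach_all_member:
  "(y, e) \<in> set ys \<Longrightarrow> (v, gs) \<in> set R \<Longrightarrow>
     (residue m (v * y), (p, e, L) # gs) \<in> set (attach_all m p L R ys)"
  by (induction m p L R ys rule: attach_all.induct) (force simp: set_attach)+

lemma attach_all_Nil: "attach_all m p L [] ys = []"
  by (induction ys) auto

fun grow :: "int \<Rightarrow> int \<Rightarrow> int \<Rightarrow> int \<times> (int \<times> int) list \<Rightarrow> (int \<times> progression list) list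
  \<Rightarrow> (int \<times> progression list) list" where
  "grow m p e (n, ys) R = attach_all m p (n - e) R ys"

definition orbit_of :: "nat \<Rightarrow> int \<Rightarrow> int \<times> int list \<Rightarrow> int \<Rightarrow> int \<Rightarrow> int \<times> (int \<times> int) list" where
  "orbit_of F m b e L = orbit F m (powers m b e) (powers m b L) e L"

text \<open>\<open>R\<close> holds the residues of the partial products with the classes chosen so
  far, so the result ranges over the product of all orbits.\<close>

fun refine :: "nat \<Rightarrow> int \<Rightarrow> (int \<times> int \<times> int list) list \<Rightarrow> progression list
  \<Rightarrow> (int \<times> progression list) list \<Rightarrow> (int \<times> progression list) list" where
  "refine F m bs [] R = R"
| "refine F m bs ((p, e, L) # gs) R =
     refine F m bs gs (grow m p e (orbit_of F m (base p bs) e L) R)"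

lemma grow_Nil: "grow m p e r [] = []"
  by (cases r) (simp add: attach_all_Nil)

lemma refine_Nil: "refine F m bs gs [] = []"
  by (induction gs) (auto simp: grow_Nil)

text \<open>Induction with \<open>z\<close> as the product of the powers already processed. A failed
  orbit empties the list for good, so a nonempty result guarantees that every orbit was
  complete.\<close>

lemma refine_covers:
  assumes m: "m > 0" and bs: "bs = base_table k m ps"
    and "covers gs x" "refine F m bs gs R \<noteq> []"
    and "(r, rs) \<in> set R" "covers rs z" "r = c * z mod m"
  shows "\<exists>gs'. (c * (z * x) mod m, gs') \<in> set (refine F m bs gs R) \<and> covers gs' (z * x)"
  using assms(3-)
proof (induction gs arbitrary: x R r rs z)
  case Nil
  then show ?case by auto
next
  case (Cons g gs)
  obtain p e L where g: "g = (p, e, L)" by (cases g)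
  obtain t y where eL: "0 \<le> e" "0 \<le> L" and y: "covers gs y" "x = p ^ (nat e + nat L * t) * y"
    using Cons.prems(1) by (auto simp: g)
  define E l where "E = nat e" and "l = nat L"
  have El: "e = int E" "L = int l" using eL by (simp_all add: E_def l_def)
  obtain n ys where orb: "orbit_of F m (base p bs) e L = (n, ys)" by fastforce
  have R': "refine F m bs gs (attach_all m p (n - e) R ys) \<noteq> []"
    using Cons.prems(2) by (simp add: g orb)
  then have ys: "ys \<noteq> []" by (auto simp: refine_Nil)
  have "[powers m (base p bs) e = p ^ E] (mod m)" "[powers m (base p bs) L = p ^ l] (mod m)"
    using powers_base[OF m] by (simp_all add: bs E_def l_def)
  moreover have "orbit F m (powers m (base p bs) e) (powers m (base p bs) L) (int E) (int l) = (n, ys)"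
    using orb by (simp add: orbit_of_def El)
  ultimately obtain y' e' L' t' where y': "(y', int e') \<in> set ys" "n - int E = int L'"
      "E + l * t = e' + L' * t'" "[y' = p ^ (E + l * t)] (mod m)"
    using orbit_powers[OF m, of _ p E _ l F n ys t] ys by metis
  define P where "P = p ^ (E + l * t)"
  have "(residue m (r * y'), (p, int e', n - e) # rs) \<in> set (attach_all m p (n - e) R ys)"
    using y'(1) Cons.prems(3) by (rule attach_all_member)
  moreover have "covers ((p, int e', n - e) # rs) (P * z)"
    using Cons.prems(4) y'(2,3) by (auto simp: El P_def)
  moreover have "residue m (r * y') = c * (P * z) mod m"
  proof -
    have "[r * y' = (c * z) * P] (mod m)"
      using y'(4) Cons.prems(5) unfolding P_def by (intro cong_mult) (auto simp: cong_def)
    then show ?thesis using m by (simp add: residue_eq_mod cong_def mult_ac)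
  qed
  ultimately have "\<exists>gs'. (c * ((P * z) * y) mod m, gs') \<in> set (refine F m bs gs (attach_all m p (n - e) R ys))
      \<and> covers gs' ((P * z) * y)"
    using Cons.IH[OF y(1) R'] by blast
  moreover have "(P * z) * y = z * x" using y(2) by (simp add: P_def E_def l_def)
  ultimately show ?case by (simp add: g orb)
qed

section \<open>Matching the residues of the two roots\<close>

datatype trie = Leaf | Node trie "int list" trie

text \<open>Keys are read by their binary digits, lowest first, so a lookup is pure pattern
  matching; the list in a node is the bucket of its key.\<close>

fun trie_lookup :: "trie \<Rightarrow> num \<Rightarrow> int list" where
  "trie_lookup Leaf n = []"
| "trie_lookup (Node l xs r) num.One = xs"
| "trie_lookup (Node l xs r) (num.Bit0 n) = trie_lookup l n"
| "trie_lookup (Node l xs r) (num.Bit1 n) = trie_lookup r n"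

fun trie_insert :: "num \<Rightarrow> int \<Rightarrow> trie \<Rightarrow> trie" where
  "trie_insert num.One d Leaf = Node Leaf [d] Leaf"
| "trie_insert (num.Bit0 n) d Leaf = Node (trie_insert n d Leaf) [] Leaf"
| "trie_insert (num.Bit1 n) d Leaf = Node Leaf [] (trie_insert n d Leaf)"
| "trie_insert num.One d (Node l xs r) = Node l (d # xs) r"
| "trie_insert (num.Bit0 n) d (Node l xs r) = Node (trie_insert n d l) xs r"
| "trie_insert (num.Bit1 n) d (Node l xs r) = Node l xs (trie_insert n d r)"

lemma trie_lookup_insert: "set (trie_lookup (trie_insert k d t) k') = (if k = k' then {d} else {}) \<union> set (trie_lookup t k')"
  by (induction k d t arbitrary: k' rule: trie_insert.induct; case_tac k') auto

definition key :: "int \<Rightarrow> num" where [code del]: "key x = num_of_nat (nat x)"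

lemma key_code [code]: "key (Int.Pos n) = n" by (simp add: key_def)

fun trie_insert_if :: "bool \<Rightarrow> num \<Rightarrow> int \<Rightarrow> trie \<Rightarrow> trie" where
  "trie_insert_if True k d t = trie_insert k d t"
| "trie_insert_if False k d t = t"

text \<open>The flag says that \<open>m\<close> divides \<open>q - 1\<close>, in which case the
  second condition of \<open>root_pair\<close> forces \<open>d * d\<close> to be 1 modulo
  \<open>m\<close>. The added \<open>m\<close> keeps the argument nonnegative.\<close>

fun admissible :: "bool \<Rightarrow> int \<Rightarrow> int \<Rightarrow> bool" where
  "admissible True m d = (residue m (d * d + m - 1) = 0)"
| "admissible False m d = True"

text \<open>
  The residues \<open>d\<close> of \<open>y - x\<close> are stored under the residue of \<open>4 x\<close> which they force, increased by 1
  because the keys have to be positive.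
\<close>

primrec differences :: "int \<Rightarrow> int \<Rightarrow> bool \<Rightarrow> int list \<Rightarrow> trie" where
  "differences q m b [] = Leaf"
| "differences q m b (d # ds) = trie_insert_if (admissible b m d)
     (key (1 + residue m (q * (d * d + m - 1) + 6 + 2 * (m - d)))) d (differences q m b ds)"

lemma lookup_differences:
  "d \<in> set ds \<Longrightarrow> admissible b m d \<Longrightarrow>
     d \<in> set (trie_lookup (differences q m b ds) (key (1 + residue m (q * (d * d + m - 1) + 6 + 2 * (m - d)))))"
proof (induction ds)
  case (Cons a ds)
  then show ?case
    by (cases "admissible b m a") (auto simp: trie_lookup_insert)
qed simp

primrec shift :: "int \<Rightarrow> int \<Rightarrow> int list \<Rightarrow> int list" where
  "shift m u [] = []"
| "shift m u (d # ds) = fit m (u + d) # shift m u ds"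

lemma set_shift: "set (shift m u ds) = (\<lambda>d. fit m (u + d)) ` set ds"
  by (induction ds) auto

primrec occurs :: "int \<Rightarrow> int list \<Rightarrow> bool" where
  "occurs x [] = False"
| "occurs x (y # ys) = (x = y \<or> occurs x ys)"

definition [code del]: "occurs' b x ys = (b \<or> occurs x ys)"

lemma occurs_code [code]:
  "occurs x [] = False"
  "occurs x (y # ys) = occurs' (x = y) x ys"
  "occurs' True x ys = True"
  "occurs' False x ys = occurs x ys"
  by (simp_all add: occurs'_def)

lemma occurs_iff: "occurs x ys \<longleftrightarrow> x \<in> set ys"
  by (induction ys) auto

primrec select :: "int \<Rightarrow> int \<Rightarrow> int list \<Rightarrow> progression list \<Rightarrow> (int \<times> progression list) list
  \<Rightarrow> state list \<Rightarrow> state list" where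
  "select c d vs gs [] rest = rest"
| "select c d vs gs (a # V) rest =
     (if occurs (fst a) vs then (c, gs, d, snd a) # select c d vs gs V rest else select c d vs gs V rest)"

definition [code del]: "select' b c d vs gs hs V rest =
  (if b then (c, gs, d, hs) # select c d vs gs V rest else select c d vs gs V rest)"
definition [code del]: "select_from = select"

lemma select_code [code]:
  "select c d vs gs [] rest = rest"
  "select c d vs gs ((v, hs) # V) rest = select' (occurs v vs) c d vs gs hs V rest"
  "select' True c d vs gs hs V rest = (c, gs, d, hs) # select c d vs gs V rest"
  "select' False c d vs gs hs V rest = select c d vs gs V rest"
  by (simp_all add: select'_def)

lemma select_from_code [code]:
  "select_from c d [] gs V rest = rest"
  "select_from c d (v # vs) gs V rest = select c d (v # vs) gs V rest"
  by (induction V) (simp_all add: select_from_def)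

lemma set_select: "set (select c d vs gs V rest) =
    {(c, gs, d, hs) | v hs. (v, hs) \<in> set V \<and> v \<in> set vs} \<union> set rest"
  by (induction V) (auto simp: occurs_iff)

text \<open>A residue \<open>u\<close> of the first root fixes that of \<open>4 x\<close>, hence the
  possible differences \<open>d\<close>, and the second root must have a residue
  \<open>u + d\<close>.\<close>

fun join :: "int \<Rightarrow> trie \<Rightarrow> int \<Rightarrow> int \<Rightarrow> (int \<times> progression list) list
  \<Rightarrow> (int \<times> progression list) list \<Rightarrow> state list" where
  "join m t c d V [] = []"
| "join m t c d V ((u, gs) # U) =
     select_from c d (shift m u (trie_lookup t (key (1 + residue m (4 * u))))) gs V (join m t c d V U)"

lemma join_member:
  "(u, gs) \<in> set U \<Longrightarrow> (v, hs) \<in> set V \<Longrightarrow>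
     v \<in> set (shift m u (trie_lookup t (key (1 + residue m (4 * u))))) \<Longrightarrow>
     (c, gs, d, hs) \<in> set (join m t c d V U)"
  by (induction m t c d V U rule: join.induct) (auto simp: select_from_def set_select)

primrec size_int :: "'a list \<Rightarrow> int" where
  "size_int [] = 0"
| "size_int (x # xs) = 1 + size_int xs"

lemma size_int: "size_int xs = int (length xs)"
  by (induction xs) auto

fun unless :: "bool \<Rightarrow> state \<Rightarrow> state list \<Rightarrow> state list" where
  "unless True s S = [s]"
| "unless False s S = S"

text \<open>When no combination of classes was eliminated, splitting would only multiply the states,
  so the old state is kept.\<close>

definition progress :: "int \<Rightarrow> state \<Rightarrow> state list \<Rightarrow> state list" where
  "progress n s S = unless (size_int S = n) s S"

text \<open>The product \<open>n\<close> of the numbers of classes vanishes if some period was not found.\<close>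

definition join_bounded :: "int \<Rightarrow> int \<Rightarrow> trie \<Rightarrow> int \<Rightarrow> progression list \<Rightarrow> int \<Rightarrow> progression list
  \<Rightarrow> (int \<times> progression list) list \<Rightarrow> (int \<times> progression list) list \<Rightarrow> state list" where
  [code del]: "join_bounded n m t c gs d hs U V =
    (if n = 0 \<or> n > 300 then [(c, gs, d, hs)] else progress n (c, gs, d, hs) (join m t c d V U))"
definition [code del]: "join_bounded' b n m t c gs d hs U V =
    (if b then [(c, gs, d, hs)] else progress n (c, gs, d, hs) (join m t c d V U))"

lemma join_bounded_code [code]:
  "join_bounded n m t c gs d hs U V =
     join_bounded' (if n = 0 then True else n > 300) n m t c gs d hs U V"
  "join_bounded' True n m t c gs d hs U V = [(c, gs, d, hs)]"
  "join_bounded' False n m t c gs d hs U V = progress n (c, gs, d, hs) (join m t c d V U)"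
  by (simp_all add: join_bounded_def join_bounded'_def)

definition combine :: "int \<Rightarrow> trie \<Rightarrow> int \<Rightarrow> progression list \<Rightarrow> int \<Rightarrow> progression list
  \<Rightarrow> (int \<times> progression list) list \<Rightarrow> (int \<times> progression list) list \<Rightarrow> state list" where
  "combine m t c gs d hs U V = join_bounded (size_int U * size_int V) m t c gs d hs U V"

fun stage :: "nat \<Rightarrow> int \<Rightarrow> trie \<Rightarrow> (int \<times> int \<times> int list) list \<Rightarrow> state list \<Rightarrow> state list" where
  "stage F m t bs [] = []"
| "stage F m t bs ((c, gs, d, hs) # S) =
     combine m t c gs d hs (refine F m bs gs [(residue m c, [])]) (refine F m bs hs [(residue m d, [])])
     @ stage F m t bs S"

primrec sieve_states :: "nat \<Rightarrow> nat \<Rightarrow> int \<Rightarrow> int list \<Rightarrow> int list \<Rightarrow> state list \<Rightarrow> state list" where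
  "sieve_states F k q ps [] S = S"
| "sieve_states F k q ps (m # ms) S = sieve_states F k q ps ms
     (stage F m (differences q m (residue m (q - 1) = 0) [0..m - 1]) (base_table k m ps) S)"

lemma differences_sound:
  assumes m: "m > 0" and xy: "root_pair q x y"
  shows "y mod m \<in> set (shift m (x mod m)
    (trie_lookup (differences q m (residue m (q - 1) = 0) [0..m - 1]) (key (1 + residue m (4 * (x mod m))))))"
proof -
  define d where "d = (y - x) mod m"
  have d: "0 \<le> d" "d < m" "[d = y - x] (mod m)" using m by (simp_all add: d_def cong_def)
  \<comment> \<open>\<open>4 x\<close> is \<open>2 (x + y) - 2 (y - x)\<close>, and the first
    condition of \<open>root_pair\<close> expresses \<open>2 (x + y)\<close> by the
    difference.\<close>
  have eq: "4 * x = q * ((y - x) * (y - x) - 1) + 6 - 2 * (y - x)"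
    and dvd: "(q - 1) dvd (y - x) * (y - x) - 1"
    using xy by (auto simp: root_pair_def power2_eq_square algebra_simps)
  have "[q * (d * d + m - 1) + 6 + 2 * (m - d) = q * ((y - x) * (y - x) + 0 - 1) + 6 + 2 * (0 - (y - x))] (mod m)"
    using d(3) by (intro cong_add cong_mult cong_diff cong_refl) (auto simp: cong_def)
  also have "q * ((y - x) * (y - x) + 0 - 1) + 6 + 2 * (0 - (y - x)) = 4 * x"
    using eq by simp
  also have "[4 * x = 4 * (x mod m)] (mod m)" by (simp add: cong_def mod_mult_right_eq)
  finally have key: "residue m (q * (d * d + m - 1) + 6 + 2 * (m - d)) = residue m (4 * (x mod m))"
    using m by (simp add: residue_eq_mod cong_def)
  have "admissible (residue m (q - 1) = 0) m d"
  proof (cases "residue m (q - 1) = 0")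
    case True
    then have "m dvd q - 1" using m by (simp add: residue_eq_mod dvd_eq_mod_eq_0)
    with dvd have "m dvd (y - x) * (y - x) - 1" by (rule dvd_trans[rotated])
    then have "[(y - x) * (y - x) + 0 - 1 = 0] (mod m)" by (simp add: cong_0_iff)
    moreover have "[d * d + m - 1 = (y - x) * (y - x) + 0 - 1] (mod m)"
      using d(3) by (intro cong_add cong_mult cong_diff cong_refl) (auto simp: cong_def)
    ultimately show ?thesis using True m by (auto simp: residue_eq_mod cong_def)
  qed simp
  from lookup_differences[OF _ this, of "[0..m - 1]" q] d key
  have "d \<in> set (trie_lookup (differences q m (residue m (q - 1) = 0) [0..m - 1]) (key (1 + residue m (4 * (x mod m)))))"
    by auto
  moreover have "fit m (x mod m + d) = y mod m"
  proof -
    have "fit m (x mod m + d) = (x mod m + d) mod m"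
      using m d pos_mod_bound[OF m, of x] pos_mod_sign[OF m, of x] by (intro fit_eq_mod) linarith+
    also have "\<dots> = y mod m" by (simp add: d_def mod_simps)
    finally show ?thesis .
  qed
  ultimately show ?thesis unfolding set_shift by (metis image_eqI)
qed

lemma stage_sound:
  assumes m: "m > 0" and xy: "root_pair q x y" and s: "s \<in> set S" "covers_pair s x y"
  shows "\<exists>s\<in>set (stage F m (differences q m (residue m (q - 1) = 0) [0..m - 1]) (base_table k m ps) S).
    covers_pair s x y"
  using s
proof (induction S)
  case (Cons a S)
  show ?case
  proof (cases "s = a")
    case False
    obtain c gs d hs where "a = (c, gs, d, hs)" by (cases a)
    then show ?thesis using Cons False by auto
  next
    case True
    obtain c gs d hs where a: "a = (c, gs, d, hs)" by (cases a)
    define t where "t = differences q m (residue m (q - 1) = 0) [0..m - 1]"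
    define U where "U = refine F m (base_table k m ps) gs [(residue m c, [])]"
    define V where "V = refine F m (base_table k m ps) hs [(residue m d, [])]"
    have "\<exists>s\<in>set (combine m t c gs d hs U V). covers_pair s x y"
    \<comment> \<open>The cases in which the state is passed on unchanged: a period was not found,
      there are too many combinations, or none was eliminated.\<close>
    proof (cases "U = [] \<or> V = [] \<or> size_int U * size_int V > 300
        \<or> size_int (join m t c d V U) = size_int U * size_int V")
      case True
      then have "combine m t c gs d hs U V = [(c, gs, d, hs)]"
        by (auto simp: combine_def join_bounded_def progress_def)
      then show ?thesis using Cons.prems(2) \<open>s = a\<close> a by simp
    next
      case False
      then have res: "combine m t c gs d hs U V = join m t c d V U"
        by (auto simp: combine_def join_bounded_def progress_def size_int)
      obtain u v where uv: "covers gs u" "covers hs v" "x = c * u" "y = d * v"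
        using Cons.prems(2) \<open>s = a\<close> a by (auto simp: covers_pair_def)
      obtain gs' where gs': "(c * (1 * u) mod m, gs') \<in> set U" "covers gs' (1 * u)"
        using refine_covers[OF m refl uv(1), of F k ps "[(residue m c, [])]" "residue m c" "[]" 1 c] False m
        by (auto simp: U_def residue_eq_mod)
      obtain hs' where hs': "(d * (1 * v) mod m, hs') \<in> set V" "covers hs' (1 * v)"
        using refine_covers[OF m refl uv(2), of F k ps "[(residue m d, [])]" "residue m d" "[]" 1 d] False m
        by (auto simp: V_def residue_eq_mod)
      have "(c, gs', d, hs') \<in> set (join m t c d V U)"
        using join_member[OF gs'(1) hs'(1)] differences_sound[OF m xy] by (simp add: uv t_def)
      moreover have "covers_pair (c, gs', d, hs') x y"
        using gs'(2) hs'(2) uv by (auto simp: covers_pair_def)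
      ultimately show ?thesis unfolding res by blast
    qed
    then show ?thesis by (auto simp: a t_def U_def V_def)
  qed
qed simp

text \<open>Each stage keeps some state that covers the pair. An empty final list therefore refutes
  all pairs covered initially.\<close>

lemma sieve_sound:
  assumes "root_pair q x y" "\<forall>m\<in>set ms. m > 0" "s \<in> set S" "covers_pair s x y"
  shows "sieve_states F k q ps ms S \<noteq> []"
  using assms
proof (induction ms arbitrary: S s)
  case (Cons m ms)
  then show ?case using stage_sound[of m q x y s S F k ps] by auto
qed auto

subsection \<open>Splitting off small exponents\<close>

text \<open>An entry \<open>(s, p, e, x)\<close> with \<open>x = p ^ e\<close> stands for a factor \<open>p ^ (e + t)\<close> of unknown exponent, of the
  second root if \<open>s\<close> holds and of the first one otherwise.\<close>

type_synonym factor = "bool \<times> int \<times> int \<times> int"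

primrec factors :: "factor list \<Rightarrow> int \<Rightarrow> int \<Rightarrow> bool" where
  "factors [] u v \<longleftrightarrow> u = 1 \<and> v = 1"
| "factors (g # gs) u v \<longleftrightarrow> (case g of (s, p, e, x) \<Rightarrow> p \<ge> 2 \<and> e \<ge> 0 \<and> x = p ^ nat e \<and>
     (\<exists>t u' v'. factors gs u' v' \<and>
       (if s then u = u' \<and> v = x * p ^ t * v' else u = x * p ^ t * u' \<and> v = v')))"

lemma factors_append:
  "factors (gs @ hs) u v \<longleftrightarrow>
     (\<exists>u1 v1 u2 v2. factors gs u1 v1 \<and> factors hs u2 v2 \<and> u = u1 * u2 \<and> v = v1 * v2)"
proof (induction gs arbitrary: u v)
  case (Cons g gs)
  obtain s p e x where g: "g = (s, p, e, x)" by (cases g)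
  show ?case
  proof
    assume "factors ((g # gs) @ hs) u v"
    then obtain t u' v' where *: "p \<ge> 2" "e \<ge> 0" "x = p ^ nat e" "factors (gs @ hs) u' v'"
      "if s then u = u' \<and> v = x * p ^ t * v' else u = x * p ^ t * u' \<and> v = v'" by (auto simp: g)
    then obtain u1 v1 u2 v2 where "factors gs u1 v1" "factors hs u2 v2" "u' = u1 * u2" "v' = v1 * v2"
      using Cons.IH by auto
    with * show "\<exists>u1 v1 u2 v2. factors (g # gs) u1 v1 \<and> factors hs u2 v2 \<and> u = u1 * u2 \<and> v = v1 * v2"
      by (intro exI[of _ "if s then u1 else x * p ^ t * u1"] exI[of _ "if s then x * p ^ t * v1 else v1"]
            exI[of _ u2] exI[of _ v2]) (auto simp: g)
  next
    assume "\<exists>u1 v1 u2 v2. factors (g # gs) u1 v1 \<and> factors hs u2 v2 \<and> u = u1 * u2 \<and> v = v1 * v2"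
    then obtain u1 v1 u2 v2 t u' v' where *: "p \<ge> 2" "e \<ge> 0" "x = p ^ nat e" "factors gs u' v'"
      "if s then u1 = u' \<and> v1 = x * p ^ t * v' else u1 = x * p ^ t * u' \<and> v1 = v'"
      "factors hs u2 v2" "u = u1 * u2" "v = v1 * v2" by (auto simp: g)
    then have "factors (gs @ hs) (u' * u2) (v' * v2)" using Cons.IH by blast
    with * show "factors ((g # gs) @ hs) u v"
      by (auto simp: g intro!: exI[of _ t] split: if_splits)
  qed
qed simp

lemma factors_pos: "factors gs u v \<Longrightarrow> u > 0 \<and> v > 0"
  by (induction gs arbitrary: u v) (auto split: if_splits)

lemma factors_dvd:
  "(s, p, e, x) \<in> set gs \<Longrightarrow> factors gs u v \<Longrightarrow>
     p \<ge> 2 \<and> e \<ge> 0 \<and> x = p ^ nat e \<and> x dvd (if s then v else u)"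
  by (induction gs arbitrary: u v) (fastforce split: if_splits)+

section \<open>Tests that refute a partial choice of exponents\<close>

fun all_side :: "bool \<Rightarrow> factor list \<Rightarrow> bool" where
  "all_side s [] = True"
| "all_side True ((True, a) # gs) = all_side True gs"
| "all_side True ((False, a) # gs) = False"
| "all_side False ((False, a) # gs) = all_side False gs"
| "all_side False ((True, a) # gs) = False"

fun least :: "int \<Rightarrow> factor list \<Rightarrow> int" where
  "least c [] = c"
| "least c ((s, p, e, x) # gs) = least (c * x) gs"

text \<open>If every open factor belongs to the second root, the first one is known, and setting all
  free exponents to 0 bounds the second one from below.\<close>

lemma least_True:
  "all_side True gs \<Longrightarrow> factors gs u v \<Longrightarrow> c > 0 \<Longrightarrow> u = 1 \<and> least c gs \<le> c * v"
proof (induction gs arbitrary: u v c)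
  case (Cons g gs)
  obtain s p e x where g: "g = (s, p, e, x)" by (cases g)
  have s: "s" and all: "all_side True gs" using Cons.prems(1) by (cases s; auto simp: g)+
  obtain t v' where *: "p \<ge> 2" "x = p ^ nat e" "factors gs u v'" "v = x * p ^ t * v'"
    using Cons.prems(2) s by (auto simp: g)
  have x: "c * x > 0" using * Cons.prems(3) by simp
  have "least (c * x) gs \<le> c * x * v'" "u = 1" using Cons.IH[OF all *(3) x] by auto
  moreover have "c * x * v' * 1 \<le> c * x * v' * p ^ t"
    using * x factors_pos[OF *(3)] by (intro mult_left_mono) auto
  ultimately show ?case using *(4) by (simp add: g mult_ac)
qed simp

lemma least_False:
  "all_side False gs \<Longrightarrow> factors gs u v \<Longrightarrow> c > 0 \<Longrightarrow> v = 1 \<and> least c gs \<le> c * u"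
proof (induction gs arbitrary: u v c)
  case (Cons g gs)
  obtain s p e x where g: "g = (s, p, e, x)" by (cases g)
  have s: "\<not> s" and all: "all_side False gs" using Cons.prems(1) by (cases s; auto simp: g)+
  obtain t u' where *: "p \<ge> 2" "x = p ^ nat e" "factors gs u' v" "u = x * p ^ t * u'"
    using Cons.prems(2) s by (auto simp: g)
  have x: "c * x > 0" using * Cons.prems(3) by simp
  have "least (c * x) gs \<le> c * x * u'" "v = 1" using Cons.IH[OF all *(3) x] by auto
  moreover have "c * x * u' * 1 \<le> c * x * u' * p ^ t"
    using * x factors_pos[OF *(3)] by (intro mult_left_mono) auto
  ultimately show ?case using *(4) by (simp add: g mult_ac)
qed simp

text \<open>With one root fixed, the quadratic equation bounds the other one.\<close>

definition too_far :: "int \<Rightarrow> int \<Rightarrow> int \<Rightarrow> bool" where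
  "too_far q x z = (if z \<ge> 2 then q * (z * z - 1) > 2 * (z + 2 * x - 3) else False)"

text \<open>Enlarging the difference from \<open>z\<close> to \<open>w\<close> adds
  \<open>q * ((w - z) * (w + z))\<close> to the left side of the equation but only
  \<open>2 * (w - z)\<close> to the right, so an excess at \<open>z\<close> persists.\<close>

lemma too_far_sound:
  assumes "root_pair q x y" "too_far q x (l - x)" "l \<le> y" "q \<ge> 1"
  shows False
proof -
  define z w where "z = l - x" and "w = y - x"
  have z: "z \<ge> 2" "q * (z * z - 1) > 2 * (z + 2 * x - 3)"
    using assms(2) by (auto simp: too_far_def z_def split: if_splits)
  have w: "w \<ge> z" using assms(3) by (simp add: z_def w_def)
  have eq: "q * (w * w - 1) = 2 * (w + 2 * x - 3)"
    using assms(1) by (simp add: root_pair_def w_def power2_eq_square algebra_simps)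
  have "q * ((w - z) * (w + z)) \<ge> 1 * ((w - z) * 2)"
    using assms(4) z w by (intro mult_mono) auto
  moreover have "q * (w * w - 1) - q * (z * z - 1) = q * ((w - z) * (w + z))"
    by (simp add: algebra_simps)
  ultimately show False using eq z(2) by (simp add: algebra_simps)
qed

definition no_pair' :: "int \<Rightarrow> int \<Rightarrow> int \<Rightarrow> bool" where
  "no_pair' q s D = (if D \<le> 0 then True else if q * D = 2 * (s - 3) then D mod (q - 1) \<noteq> 0 else True)"

definition no_pair :: "int \<Rightarrow> int \<Rightarrow> int \<Rightarrow> bool" where
  "no_pair q x y = no_pair' q (x + y) ((y - x) * (y - x) - 1)"

lemma no_pair_sound: "no_pair q x y \<Longrightarrow> \<not> root_pair q x y"
  by (auto simp: no_pair_def no_pair'_def root_pair_def power2_eq_square dvd_eq_mod_eq_0 split: if_splits)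

text \<open>The power of the same prime in the other root. The default 0 cannot be a power of a
  prime and means that the other root has no open factor of it.\<close>

fun mate :: "bool \<Rightarrow> int \<Rightarrow> factor list \<Rightarrow> int" where
  "mate s p [] = 0"
| "mate s p ((s', p', e', x') # gs) = (if p' = p \<and> s' \<noteq> s then x' else mate s p gs)"

definition [code del]: "mate' b s s' p x' gs = (if b \<and> s' \<noteq> s then x' else mate s p gs)"

lemma mate_code [code]:
  "mate s p [] = 0"
  "mate s p ((s', p', e', x') # gs) = mate' (p' = p) s s' p x' gs"
  "mate' False s s' p x' gs = mate s p gs"
  "mate' True True False p x' gs = x'"
  "mate' True False True p x' gs = x'"
  "mate' True True True p x' gs = mate True p gs"
  "mate' True False False p x' gs = mate False p gs"
  by (simp_all add: mate'_def)

lemma mate_member: "mate s p gs \<noteq> 0 \<Longrightarrow> \<exists>e. (\<not> s, p, e, mate s p gs) \<in> set gs"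
  by (induction s p gs rule: mate.induct) (auto split: if_splits)

text \<open>For powers of the same prime the smaller one divides both roots and hence
  \<open>q - 6\<close>. A power equal to 1 carries no information.\<close>

definition incompatible :: "int \<Rightarrow> int \<Rightarrow> int \<Rightarrow> bool" where
  "incompatible q x y = (if y = 0 then False else if x = 1 then False else if y = 1 then False
     else if x \<le> y then (q - 6) mod x \<noteq> 0 else (q - 6) mod y \<noteq> 0)"

text \<open>The equation of a root pair reads
  \<open>q - 6 = q (y - x)^2 - 2 x - 2 y\<close>.\<close>

lemma common_dvd: "root_pair q x y \<Longrightarrow> m dvd x \<Longrightarrow> m dvd y \<Longrightarrow> m dvd q - 6"
proof -
  assume xy: "root_pair q x y" and m: "m dvd x" "m dvd y"
  have "q - 6 = q * ((y - x) * (y - x)) - 2 * x - 2 * y"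
    using xy by (simp add: root_pair_def power2_eq_square algebra_simps)
  then show "m dvd q - 6" using m by (auto intro!: dvd_diff dvd_mult)
qed

lemma power_le_imp_dvd:
  assumes "(p::int) \<ge> 2" "p ^ a \<le> p ^ b"
  shows "p ^ a dvd p ^ b"
proof -
  have "a \<le> b" using assms power_le_imp_le_exp[of p a b] by simp
  then show ?thesis by (rule le_imp_power_dvd)
qed

fun clash :: "int \<Rightarrow> factor list \<Rightarrow> bool" where
  "clash q [] = False"
| "clash q ((s, p, e, x) # gs) = (if incompatible q x (mate s p gs) then True else clash q gs)"

definition [code del]: "clash' b q gs = (b \<or> clash q gs)"

lemma clash_code [code]:
  "clash q [] = False"
  "clash q ((s, p, e, x) # gs) = clash' (incompatible q x (mate s p gs)) q gs"
  "clash' True q gs = True"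
  "clash' False q gs = clash q gs"
  by (simp_all add: clash'_def)

lemma clash_sound:
  assumes "clash q gs" "factors gs u v"
  shows "\<not> root_pair q (c * u) (d * v)"
  using assms
proof (induction gs arbitrary: u v c d)
  case (Cons g gs)
  obtain s p e x where g: "g = (s, p, e, x)" by (cases g)
  obtain t u' v' where *: "p \<ge> 2" "e \<ge> 0" "x = p ^ nat e" "factors gs u' v'"
      "if s then u = u' \<and> v = x * p ^ t * v' else u = x * p ^ t * u' \<and> v = v'"
    using Cons.prems(2) by (auto simp: g)
  show ?case
  proof (cases "incompatible q x (mate s p gs)")
    case False
    then have "clash q gs" using Cons.prems(1) by (simp add: g)
    \<comment> \<open>The factor just passed is absorbed into the constants, which is why
      \<open>c\<close> and \<open>d\<close> vary in the induction.\<close>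
    from Cons.IH[OF this *(4), of "if s then c else c * x * p ^ t" "if s then d * x * p ^ t else d"] *(5)
    show ?thesis by (auto simp: mult_ac split: if_splits)
  next
    case True
    define y where "y = mate s p gs"
    have "y \<noteq> 0" using True by (auto simp: incompatible_def y_def)
    then obtain e' where "(\<not> s, p, e', y) \<in> set gs" using mate_member[of s p gs] by (auto simp: y_def)
    from factors_dvd[OF this *(4)] have y: "y = p ^ nat e'" "y dvd (if s then u' else v')" by auto
    show ?thesis
    proof
      assume xy: "root_pair q (c * u) (d * v)"
      have "x dvd (if s then d * v else c * u)" "y dvd (if s then c * u else d * v)"
        using *(5) y(2) by (auto split: if_splits)
      then have both: "z dvd c * u \<and> z dvd d * v" if "z dvd x" "z dvd y" for z
        using that by (auto split: if_splits intro: dvd_trans)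
      consider "x \<le> y" "\<not> x dvd q - 6" | "y \<le> x" "\<not> y dvd q - 6"
        using True by (auto simp: incompatible_def y_def[symmetric] dvd_eq_mod_eq_0 split: if_splits)
      then show False
      proof cases
        case 1
        then have "x dvd y" using *(1,3) y(1) power_le_imp_dvd by metis
        then show ?thesis using 1 common_dvd[OF xy] both[of x] by auto
      next
        case 2
        then have "y dvd x" using *(1,3) y(1) power_le_imp_dvd by metis
        then show ?thesis using 2 common_dvd[OF xy] both[of y] by auto
      qed
    qed
  qed
qed simp

text \<open>\<open>a\<close> says that the first root is the known number \<open>c\<close>,
  \<open>b\<close> that the second is \<open>d\<close>. With no open factor left, both are known and
  the conditions are tested directly.\<close>

definition dead :: "bool \<Rightarrow> bool \<Rightarrow> int \<Rightarrow> int \<Rightarrow> int \<Rightarrow> factor list \<Rightarrow> bool" where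
  [code del]: "dead a b q c d gs = (if a then if gs = [] then no_pair q c d else too_far q c (least d gs - c)
     else if b then too_far q d (least c gs - d) else clash q gs)"

lemma dead_code [code]:
  "dead True b q c d [] = no_pair q c d"
  "dead True b q c d (g # gs) = too_far q c (least d (g # gs) - c)"
  "dead False True q c d gs = too_far q d (least c gs - d)"
  "dead False False q c d gs = clash q gs"
  by (simp_all add: dead_def)

lemma dead_sound:
  assumes "dead (all_side True gs) (all_side False gs) q c d gs" "factors gs u v" "c > 0" "d > 0" "q \<ge> 1"
  shows "\<not> root_pair q (c * u) (d * v)"
proof
  assume xy: "root_pair q (c * u) (d * v)"
  show False
  proof (cases "all_side True gs")
    case True
    show ?thesis
    proof (cases "gs = []")
      case True
      then show ?thesis using assms(1,2) xy no_pair_sound by (auto simp: dead_def)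
    next
      case False
      then show ?thesis
        using True assms xy least_True[OF True assms(2,4)] too_far_sound[of q c "d * v" "least d gs"]
        by (auto simp: dead_def)
    qed
  next
    case False
    then show ?thesis
      using assms xy least_False[OF _ assms(2,3)] clash_sound[OF _ assms(2)]
        too_far_sound[of q d "c * u" "least c gs"] root_pair_commute[of q d "c * u"]
      by (auto simp: dead_def split: if_splits)
  qed
qed

section \<open>The search tree over the exponents\<close>

fun smallest :: "int \<Rightarrow> factor list \<Rightarrow> bool" where
  "smallest e [] = True"
| "smallest e ((s, p, e', x) # gs) = (if e \<le> e' then smallest e gs else False)"

text \<open>For a prime open in both roots the smaller power is raised, which drives the two towards
  a clash with \<open>q - 6\<close>. A prime open in one root only is raised until its power
  vanishes modulo \<open>p\<close>, or modulo \<open>2 ^ k\<close> for the prime 2; its residues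
  there are then constant.\<close>

definition small_exponent :: "int \<Rightarrow> int \<Rightarrow> int \<Rightarrow> int \<Rightarrow> int \<Rightarrow> bool" where
  "small_exponent k p e x y = (if y = 0 then (if p = 2 then e < k else e = 0) else x \<le> y)"

text \<open>When one root is known (\<open>lone\<close>), a factor with the smallest exponent is
  raised, so that the lower bound for the other root grows until it is too far.\<close>

definition branch_on :: "bool \<Rightarrow> int \<Rightarrow> factor list \<Rightarrow> factor \<Rightarrow> bool" where
  [code del]: "branch_on lone k gs = (\<lambda>(s, p, e, x).
     if lone then smallest e gs else small_exponent k p e x (mate s p gs))"

lemma branch_on_code [code]:
  "branch_on True k gs (s, p, e, x) = smallest e gs"
  "branch_on False k gs (s, p, e, x) = small_exponent k p e x (mate s p gs)"
  by (simp_all add: branch_on_def)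

primrec pick :: "bool \<Rightarrow> int \<Rightarrow> factor list \<Rightarrow> factor list \<Rightarrow> factor list \<Rightarrow> factor list \<times> factor list" where
  "pick lone k all acc [] = ([], [])"
| "pick lone k all acc (g # gs) = (if branch_on lone k all g then (acc, g # gs) else pick lone k all (g # acc) gs)"

definition [code del]: "pick' b lone k all acc g gs =
  (if b then (acc, g # gs) else pick lone k all (g # acc) gs)"

lemma pick_code [code]:
  "pick lone k all acc [] = ([], [])"
  "pick lone k all acc (g # gs) = pick' (branch_on lone k all g) lone k all acc g gs"
  "pick' True lone k all acc g gs = (acc, g # gs)"
  "pick' False lone k all acc g gs = pick lone k all (g # acc) gs"
  by (simp_all add: pick'_def)

lemma pick_rev: "pick lone k all acc gs = (is, g # hs) \<Longrightarrow> rev acc @ gs = rev is @ g # hs"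
  by (induction gs arbitrary: acc) (fastforce split: if_splits)+

fun progressions_of :: "bool \<Rightarrow> factor list \<Rightarrow> progression list" where
  "progressions_of s [] = []"
| "progressions_of True ((True, p, e, x) # gs) = (p, e, 1) # progressions_of True gs"
| "progressions_of True ((False, p, e, x) # gs) = progressions_of True gs"
| "progressions_of False ((False, p, e, x) # gs) = (p, e, 1) # progressions_of False gs"
| "progressions_of False ((True, p, e, x) # gs) = progressions_of False gs"

lemma covers_progressions_of: "factors gs u v \<Longrightarrow> covers (progressions_of False gs) u \<and> covers (progressions_of True gs) v"
proof (induction gs arbitrary: u v)
  case (Cons g gs)
  obtain s p e x where g: "g = (s, p, e, x)" by (cases g)
  show ?case using Cons by (cases s) (force simp: g power_add)+
qed simp

text \<open>Either the unknown exponent is exactly \<open>e\<close>, and the power moves into the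
  constant, or it is at least \<open>e + 1\<close>. Exhausted fuel yields a leaf for the sieve,
  which loses no pair.\<close>

primrec leaves :: "nat \<Rightarrow> int \<Rightarrow> int \<Rightarrow> int \<Rightarrow> int \<Rightarrow> factor list \<Rightarrow> state list" where
  "leaves 0 k q c d gs = [(c, progressions_of False gs, d, progressions_of True gs)]"
| "leaves (Suc f) k q c d gs =
    (if dead (all_side True gs) (all_side False gs) q c d gs then []
     else case pick (all_side True gs \<or> all_side False gs) k gs [] gs of
       (is, []) \<Rightarrow> [(c, progressions_of False gs, d, progressions_of True gs)]
     | (is, (s, p, e, x) # hs) \<Rightarrow>
         leaves f k q (if s then c else c * x) (if s then d * x else d) (rev is @ hs) @
         leaves f k q c d (rev is @ (s, p, e + 1, x * p) # hs))"

definition [code del]: "expand r f k q c d gs = (case r of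
       (is, []) \<Rightarrow> [(c, progressions_of False gs, d, progressions_of True gs)]
     | (is, (s, p, e, x) # hs) \<Rightarrow>
         leaves f k q (if s then c else c * x) (if s then d * x else d) (rev is @ hs) @
         leaves f k q c d (rev is @ (s, p, e + 1, x * p) # hs))"
definition [code del]: "prune b lone f k q c d gs =
  (if b then [] else expand (pick lone k gs [] gs) f k q c d gs)"
definition [code del]: "leaves' a b f k q c d gs = prune (dead a b q c d gs) (a \<or> b) f k q c d gs"

lemma leaves_code [code]:
  "leaves 0 k q c d gs = [(c, progressions_of False gs, d, progressions_of True gs)]"
  "leaves (Suc f) k q c d gs = leaves' (all_side True gs) (all_side False gs) f k q c d gs"
  "leaves' a b f k q c d gs = prune (dead a b q c d gs) (a \<or> b) f k q c d gs"
  "prune True lone f k q c d gs = []"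
  "prune False lone f k q c d gs = expand (pick lone k gs [] gs) f k q c d gs"
  "expand (is, []) f k q c d gs = [(c, progressions_of False gs, d, progressions_of True gs)]"
  "expand (is, (False, p, e, x) # hs) f k q c d gs =
     leaves f k q (c * x) d (rev is @ hs) @ leaves f k q c d (rev is @ (False, p, e + 1, x * p) # hs)"
  "expand (is, (True, p, e, x) # hs) f k q c d gs =
     leaves f k q c (d * x) (rev is @ hs) @ leaves f k q c d (rev is @ (True, p, e + 1, x * p) # hs)"
  by (simp_all add: leaves'_def prune_def expand_def)

lemma leaves_sound:
  assumes "factors gs u v" "root_pair q (c * u) (d * v)" "c > 0" "d > 0" "q \<ge> 1"
  shows "\<exists>s\<in>set (leaves f k q c d gs). covers_pair s (c * u) (d * v)"
  using assms
proof (induction f arbitrary: gs u v c d)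
  case 0
  then show ?case using covers_progressions_of by (fastforce simp: covers_pair_def)
next
  case (Suc f)
  have alive: "\<not> dead (all_side True gs) (all_side False gs) q c d gs"
    using dead_sound Suc.prems by blast
  obtain "is" js where pick: "pick (all_side True gs \<or> all_side False gs) k gs [] gs = (is, js)"
    by fastforce
  show ?case
  proof (cases js)
    case Nil
    then show ?thesis using alive pick covers_progressions_of[OF Suc.prems(1)] by (auto simp: covers_pair_def)
  next
    case (Cons g hs)
    obtain s p e x where g: "g = (s, p, e, x)" by (cases g)
    have "gs = rev is @ (s, p, e, x) # hs" using pick_rev pick Cons g by fastforce
    then obtain u1 v1 u2 v2 where uv: "factors (rev is) u1 v1" "factors ((s, p, e, x) # hs) u2 v2"
        "u = u1 * u2" "v = v1 * v2"
      using Suc.prems(1) by (auto simp only: factors_append)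
    then obtain t u' v' where *: "p \<ge> 2" "e \<ge> 0" "x = p ^ nat e" "factors hs u' v'"
        "if s then u2 = u' \<and> v2 = x * p ^ t * v' else u2 = x * p ^ t * u' \<and> v2 = v'" by auto
    have x: "x > 0" using * by simp
    have step: "leaves (Suc f) k q c d gs =
        leaves f k q (if s then c else c * x) (if s then d * x else d) (rev is @ hs) @
        leaves f k q c d (rev is @ (s, p, e + 1, x * p) # hs)"
      using alive pick Cons g by simp
    show ?thesis
    proof (cases t)
      case 0
      have "factors (rev is @ hs) (u1 * u') (v1 * v')" using uv(1) *(4) factors_append by blast
      moreover have "(if s then c else c * x) * (u1 * u') = c * u"
        "(if s then d * x else d) * (v1 * v') = d * v"
        using 0 *(5) uv(3,4) by (auto simp: mult_ac)
      ultimately show ?thesis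
        using Suc.IH[of "rev is @ hs" "u1 * u'" "v1 * v'" "if s then c else c * x" "if s then d * x else d"]
          Suc.prems x unfolding step by auto
    next
      case (Suc t')
      have "nat (e + 1) = Suc (nat e)" using *(2) by simp
      then have "factors ((s, p, e + 1, x * p) # hs) u2 v2"
        using * Suc by (auto intro!: exI[of _ t'])
      then have "factors (rev is @ (s, p, e + 1, x * p) # hs) u v"
        using uv factors_append by blast
      from Suc.IH[OF this Suc.prems(2-5)] show ?thesis unfolding step by auto
    qed
  qed
qed

section \<open>Factorizations of the roots for even and odd alphabet sizes\<close>

lemma factors_of_primes:
  assumes "x > 0" "\<forall>p\<in>set ps. prime p" "\<And>r. prime r \<Longrightarrow> r dvd x \<Longrightarrow> r \<in> set ps"
  shows "factors (map (\<lambda>p. (s, p, 0, 1)) ps) (if s then 1 else x) (if s then x else 1)"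
  using assms
proof (induction ps arbitrary: x)
  case Nil
  then have "is_unit x" using prime_divisor_exists[of x] by fastforce
  then show ?case using Nil by simp
next
  case (Cons p ps)
  have p: "prime p" using Cons.prems(2) by simp
  obtain k y where y: "x = p ^ k * y" "\<not> p dvd y"
    using multiplicity_decompose'[of x p] Cons.prems(1) p by (metis not_prime_unit less_irrefl)
  have pos: "y > 0" using y(1) Cons.prems(1) p prime_gt_0_int[OF p]
    by (metis zero_less_mult_pos zero_less_power)
  have ps: "r \<in> set ps" if "prime r" "r dvd y" for r
  proof -
    have "r dvd x" using that(2) y(1) by simp
    then have "r \<in> set (p # ps)" using Cons.prems(3)[OF that(1)] by blast
    moreover have "r \<noteq> p" using that(2) y(2) by auto
    ultimately show ?thesis by simp
  qed
  have sub: "factors (map (\<lambda>p. (s, p, 0, 1)) ps) (if s then 1 else y) (if s then y else 1)"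
    by (rule Cons.IH[OF pos _ ps]) (use Cons.prems(2) in auto)
  show ?case
  proof (cases s)
    case True
    then have "\<exists>t v'. factors (map (\<lambda>p. (s, p, 0, 1)) ps) 1 v' \<and> x = p ^ t * v'" using sub y(1) by auto
    then show ?thesis using True prime_ge_2_int[OF p] by simp
  next
    case False
    then have "\<exists>t u'. factors (map (\<lambda>p. (s, p, 0, 1)) ps) u' 1 \<and> x = p ^ t * u'" using sub y(1) by auto
    then show ?thesis using False prime_ge_2_int[OF p] by simp
  qed
qed

lemma factors_first:
  assumes "x > 0" "\<forall>p\<in>set ps. prime p" "\<And>r. prime r \<Longrightarrow> r dvd x \<Longrightarrow> r \<in> set ps"
  shows "factors (map (\<lambda>p. (False, p, 0, 1)) ps) x 1"
  using factors_of_primes[OF assms, of False] by simp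

lemma factors_second:
  assumes "y > 0" "\<forall>p\<in>set ps. prime p" "\<And>r. prime r \<Longrightarrow> r dvd y \<Longrightarrow> r \<in> set ps"
  shows "factors (map (\<lambda>p. (True, p, 0, 1)) ps) 1 y"
  using factors_of_primes[OF assms, of True] by simp

text \<open>
  By symmetry the second root may be assumed even if \<open>q\<close> is odd. If \<open>q\<close> is even, it may be assumed prime to
  the largest prime of \<open>q\<close> exceeding 3, which cannot divide both roots.
\<close>

definition initial_factors :: "int \<Rightarrow> int list \<Rightarrow> factor list" where
  "initial_factors q ps = map (\<lambda>p. (False, p, 0, 1)) ps @
     map (\<lambda>p. (True, p, 0, 1)) (if even q \<and> last ps \<ge> 5 then butlast ps else ps)"

text \<open>60 bounds the depth of the search tree, 64 the length of an orbit and 10 the number of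
  stored squares. They limit only what can be refuted; soundness holds for all values.\<close>

definition excluded :: "int \<times> int list \<times> int \<times> int list \<Rightarrow> bool" where
  "excluded = (\<lambda>(q, ps, k, ms). list_all (\<lambda>m. m > 0) ms \<and>
     sieve_states 64 10 q ps ms (leaves 60 k q 1 (if even q then 1 else 2) (initial_factors q ps)) = [])"

lemma excluded_initial:
  assumes "excluded (q, ps, k, ms)" "q \<ge> 1" "factors (initial_factors q ps) u v"
  shows "\<not> root_pair q u ((if even q then 1 else 2) * v)"
proof
  define d :: int where "d = (if even q then 1 else 2)"
  assume "root_pair q u ((if even q then 1 else 2) * v)"
  then have rp: "root_pair q (1 * u) (d * v)" by (simp add: d_def)
  have "d > 0" by (simp add: d_def)
  then obtain s where s: "s \<in> set (leaves 60 k q 1 d (initial_factors q ps))" "covers_pair s (1 * u) (d * v)"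
    using leaves_sound[OF assms(3) rp _ _ assms(2), of 60 k] by auto
  from sieve_sound[OF rp _ s, of ms 64 10 ps] assms(1) show False
    by (simp add: excluded_def list_all_iff d_def)
qed

lemma excluded_even:
  assumes ex: "excluded (q, ps, k, ms)" and q: "q \<ge> 1" "even q" and ps: "ps \<noteq> []" "\<forall>p\<in>set ps. prime p \<and> p dvd q"
    and xy: "x > 0" "y > 0" "\<And>r. prime r \<Longrightarrow> r dvd x * y \<Longrightarrow> r \<in> set ps"
  shows "\<not> root_pair q x y"
proof -
  have main: "\<not> root_pair q x y"
    if pos: "x > 0" "y > 0" and r: "\<And>r. prime r \<Longrightarrow> r dvd x * y \<Longrightarrow> r \<in> set ps"
      and last: "last ps \<ge> 5 \<Longrightarrow> \<not> last ps dvd y" for x y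
  proof -
    define qs where "qs = (if even q \<and> last ps \<ge> 5 then butlast ps else ps)"
    have qs: "r \<in> set qs" if "prime r" "r dvd y" for r
    proof -
      have "r \<in> set ps" using r[OF that(1)] that(2) by simp
      moreover have "set ps = set (butlast ps @ [last ps])" using ps(1) by simp
      ultimately have "r \<in> set (butlast ps) \<or> r = last ps" unfolding set_append by auto
      then show ?thesis using \<open>r \<in> set ps\<close> that(2) last by (auto simp: qs_def)
    qed
    have "\<forall>p\<in>set qs. prime p" using ps(2) by (auto simp: qs_def dest: in_set_butlastD)
    from factors_second[OF pos(2) this qs]
    have "factors (map (\<lambda>p. (True, p, 0, 1)) qs) 1 y" .
    moreover have "factors (map (\<lambda>p. (False, p, 0, 1)) ps) x 1"
      by (rule factors_first[OF pos(1)]) (use ps(2) r in auto)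
    ultimately have "factors (initial_factors q ps) (x * 1) (1 * y)"
      unfolding initial_factors_def qs_def[symmetric] using factors_append by blast
    then show ?thesis using excluded_initial[OF ex q(1), of x y] q(2) by simp
  qed
  show ?thesis
  proof
    assume rp: "root_pair q x y"
    \<comment> \<open>A prime of \<open>q\<close> dividing both roots divides \<open>q - 6\<close>,
      hence 6, and is at most 3.\<close>
    have "\<not> last ps dvd x \<or> \<not> last ps dvd y" if "last ps \<ge> 5"
    proof (rule ccontr)
      assume "\<not> ?thesis"
      then have "last ps dvd q - 6" using common_dvd[OF rp, of "last ps"] by simp
      moreover have P: "prime (last ps)" "last ps dvd q" using ps by auto
      ultimately have "last ps dvd q - (q - 6)" using dvd_diff by blast
      then have "last ps dvd 2 * 3" by simp
      then have "last ps dvd 2 \<or> last ps dvd 3" using P(1) prime_dvd_mult_iff by blast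
      then show False using that zdvd_imp_le[of "last ps" 2] zdvd_imp_le[of "last ps" 3] by auto
    qed
    then show False
      using main[OF xy] main[OF xy(2,1)] rp xy(3) root_pair_commute[of q x y] by (auto simp: mult.commute)
  qed
qed

lemma excluded_odd:
  assumes ex: "excluded (q, ps, k, ms)" and q: "q \<ge> 1" "odd q" and ps: "\<forall>p\<in>set ps. prime p"
    and xy: "x > 0" "y > 0" "x * y = 2 * z" and z: "\<And>r. prime r \<Longrightarrow> r dvd z \<Longrightarrow> r \<in> set ps"
  shows "\<not> root_pair q x y"
proof -
  have main: "\<not> root_pair q x (2 * w)" if "x > 0" "w > 0" "x * w = z" for x w
  proof -
    have "factors (map (\<lambda>p. (True, p, 0, 1)) ps) 1 w"
      by (rule factors_second[OF that(2) ps z]) (use that(3) in auto)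
    moreover have "factors (map (\<lambda>p. (False, p, 0, 1)) ps) x 1"
      by (rule factors_first[OF that(1) ps z]) (use that(3) in auto)
    ultimately have "factors (map (\<lambda>p. (False, p, 0, 1)) ps @ map (\<lambda>p. (True, p, 0, 1)) ps) (x * 1) (1 * w)"
      unfolding factors_append by blast
    then have "factors (initial_factors q ps) (x * 1) (1 * w)" using q(2) by (simp add: initial_factors_def)
    then show ?thesis using excluded_initial[OF ex q(1), of x w] q(2) by simp
  qed
  \<comment> \<open>The factor 2 can be taken from one of the roots, by symmetry from the second;
    the cofactors multiply to \<open>z\<close>.\<close>
  have "even x \<or> even y" using xy(3) by (metis dvd_triv_left even_mult_iff)
  then show ?thesis
  proof
    assume "even x"
    then obtain w where w: "x = 2 * w" by (auto elim: evenE)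
    then show ?thesis using main[of y w] xy root_pair_commute[of q x y] by (auto simp: mult_ac)
  next
    assume "even y"
    then obtain w where w: "y = 2 * w" by (auto elim: evenE)
    then show ?thesis using main[of x w] xy by auto
  qed
qed

section \<open>The alphabet of size 6\<close>

lemma no_root_pair_6:
  assumes "root_pair 6 x y" and pr: "\<And>r :: int. prime r \<Longrightarrow> r dvd x * y \<Longrightarrow> r = 2 \<or> r = 3"
  shows False
proof -
  define d where "d = y - x"
  have "x + y = 3 * (d * d)" and dd: "d * d > 1"
    using assms(1) by (simp_all add: root_pair_def d_def power2_eq_square algebra_simps)
  then have x2: "2 * x = (3 * d - 1) * d" and y2: "2 * y = (3 * d + 1) * d"
    by (simp_all add: d_def algebra_simps)
  \<comment> \<open>The prime 3 divides neither \<open>3 * d - 1\<close> nor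
    \<open>3 * d + 1\<close>, so only 2 is left.\<close>
  have two: "r = 2" if "prime r" "r dvd 3 * d - 1 \<or> r dvd 3 * d + 1" for r :: int
  proof -
    have "r dvd 2 * x \<or> r dvd 2 * y" using that(2) unfolding x2 y2 by auto
    then have "r dvd 2 \<or> r dvd x * y" using that(1) by (auto simp: prime_dvd_mult_iff)
    then have "r = 2 \<or> r = 3" using pr that(1) primes_dvd_imp_eq[of r 2] by auto
    moreover have "\<not> (3::int) dvd 3 * d - 1" "\<not> (3::int) dvd 3 * d + 1" by presburger+
    ultimately show ?thesis using that(2) by auto
  qed
  have odd: "w = 1 \<or> w = - 1" if "odd w" "w dvd 3 * d - 1 \<or> w dvd 3 * d + 1" for w
  proof (rule ccontr)
    assume "\<not> ?thesis"
    then have "\<not> is_unit w" by auto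
    moreover have "w \<noteq> 0" using that(1) by auto
    ultimately obtain r where "prime r" "r dvd w" using prime_divisor_exists by blast
    then show False using two[of r] that by (auto intro: dvd_trans)
  qed
  have small: "d \<noteq> 0" "d \<noteq> 1" "d \<noteq> - 1" using dd by auto
  \<comment> \<open>In each class one of \<open>3 * d - 1\<close> and \<open>3 * d + 1\<close> is
    odd or twice an odd number, so it is 1 or 2 up to sign. This leaves only 0, 1 and -1 for
    \<open>d\<close>.\<close>
  have "even d \<or> d mod 4 = 1 \<or> d mod 4 = 3" by presburger
  then consider "even d" | "d mod 4 = 1" | "d mod 4 = 3" by blast
  then show False
  proof cases
    case 1
    then have "3 * d - 1 = 1 \<or> 3 * d - 1 = - 1" by (intro odd) auto
    then show ?thesis using small by presburger
  next
    case 2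
    define w where "w = (3 * d - 1) div 2"
    with 2 have "3 * d - 1 = 2 * w" "odd w" by presburger+
    then have "w = 1 \<or> w = - 1" by (intro odd) auto
    then show ?thesis using small \<open>3 * d - 1 = 2 * w\<close> by presburger
  next
    case 3
    define w where "w = (3 * d + 1) div 2"
    with 3 have "3 * d + 1 = 2 * w" "odd w" by presburger+
    then have "w = 1 \<or> w = - 1" by (intro odd) auto
    then show ?thesis using small \<open>3 * d + 1 = 2 * w\<close> by presburger
  qed
qed

section \<open>The alphabet sizes\<close>

text \<open>
  An entry \<open>(q, ps, k, ms)\<close> lists the primes \<open>ps\<close> of \<open>q\<close>, the least exponent \<open>k\<close> from which on powers of 2 are
  treated as unbounded, and the moduli \<open>ms\<close> of the sieve, which were found by a greedy search.
\<close>

definition certificates_1 :: "(int \<times> int list \<times> int \<times> int list) list" where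
  "certificates_1 =
  [(10, [2, 5], 1, [5, 8, 9, 7]),
   (12, [2, 3], 1, [3, 4, 11, 31]),
   (14, [2, 7], 1, [7]),
   (15, [3, 5], 1, [3, 13, 7, 19]),
   (18, [2, 3], 1, [3, 7]),
   (20, [2, 5], 1, [5, 8]),
   (21, [3, 7], 1, [3, 7, 8, 5]),
   (22, [2, 11], 1, [11, 5, 8, 3, 61]),
   (24, [2, 3], 2, [4, 3, 9, 7, 8, 13]),
   (26, [2, 13], 5, [8, 3, 5, 32]),
   (28, [2, 7], 1, [7]),
   (30, [2, 3, 5], 4, [3, 8, 16, 5, 32, 7, 13, 19]),
   (33, [3, 11], 1, [11, 3, 9, 5, 7, 19]),
   (34, [2, 17], 1, [17]),
   (35, [5, 7], 1, [3, 7, 5, 8]),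
   (36, [2, 3], 1, [3, 7]),
   (38, [2, 19], 3, [3, 8, 9, 19, 5, 7, 13]),
   (39, [3, 13], 1, [3, 13, 7, 19]),
   (40, [2, 5], 1, [5, 8]),
   (42, [2, 3, 7], 3, [3, 8, 7, 9, 16, 13, 5, 73, 19]),
   (44, [2, 11], 1, [11, 4, 5]),
   (45, [3, 5], 1, [3, 5, 8]),
   (46, [2, 23], 4, [16, 5, 13, 7]),
   (48, [2, 3], 1, [3, 4, 7, 13, 5]),
   (50, [2, 5], 1, [5, 8, 3, 7]),
   (51, [3, 17], 1, [3, 8, 17, 5]),
   (52, [2, 13], 1, [3, 4, 13]),
   (54, [2, 3], 1, [3, 7, 13, 17]),
   (55, [5, 11], 1, [5]),
   (56, [2, 7], 1, [7]),
   (57, [3, 19], 1, [3, 7, 5]),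
   (58, [2, 29], 3, [8, 5, 3, 29]),
   (60, [2, 3, 5], 2, [4, 3, 5, 8, 7, 13, 16]),
   (62, [2, 31], 1, [31]),
   (63, [3, 7], 1, [3, 9, 7, 8, 13]),
   (65, [5, 13], 1, [13, 7]),
   (66, [2, 3, 11], 1, [3, 8, 5, 16, 13, 7, 37, 11]),
   (68, [2, 17], 1, [17]),
   (69, [3, 23], 1, [3, 11, 9, 8, 5, 13, 7]),
   (70, [2, 5, 7], 2, [7, 3, 9, 19, 13, 5, 37])]"

definition certificates_2 :: "(int \<times> int list \<times> int \<times> int list) list" where
  "certificates_2 =
  [(72, [2, 3], 1, [3, 7]),
   (74, [2, 37], 3, [8, 3, 19, 37]),
   (75, [3, 5], 1, [3, 5, 8]),
   (76, [2, 19], 1, [3, 4, 5, 19, 8]),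
   (77, [7, 11], 1, [7]),
   (78, [2, 3, 13], 1, [3, 7, 13, 16, 5, 17, 27]),
   (80, [2, 5], 1, [5, 8]),
   (82, [2, 41], 2, [7, 8, 3, 16]),
   (84, [2, 3, 7], 2, [3, 4, 7, 8, 13, 37]),
   (85, [5, 17], 1, [5, 3, 13, 17]),
   (86, [2, 43], 1, [3, 43]),
   (87, [3, 29], 1, [3, 9, 7, 8, 13, 27, 19]),
   (88, [2, 11], 1, [11, 4, 3, 5, 17]),
   (90, [2, 3, 5], 3, [3, 8, 5, 7, 13, 32, 9]),
   (91, [7, 13], 1, [7]),
   (92, [2, 23], 1, [23, 16]),
   (93, [3, 31], 1, [3, 13, 19]),
   (95, [5, 19], 1, [5, 7]),
   (96, [2, 3], 1, [4, 3, 9, 5, 8, 13, 17]),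
   (98, [2, 7], 1, [7]),
   (99, [3, 11], 1, [3, 7]),
   (100, [2, 5], 1, [5, 8]),
   (102, [2, 3, 17], 5, [3, 8, 16, 9, 27, 32, 7, 13, 17]),
   (104, [2, 13], 1, [3, 4, 7, 13, 5]),
   (105, [3, 5, 7], 1, [3, 13, 7, 5, 8]),
   (106, [2, 53], 3, [8, 5, 9, 53]),
   (108, [2, 3], 2, [3, 4, 13, 9]),
   (110, [2, 5, 11], 4, [5, 8, 16, 3, 13, 17])]"

definition certificates_3 :: "(int \<times> int list \<times> int \<times> int list) list" where
  "certificates_3 =
  [(111, [3, 37], 1, [3, 7, 13]),
   (112, [2, 7], 1, [7]),
   (114, [2, 3, 19], 3, [3, 8, 7, 13, 5, 16, 19, 37]),
   (115, [5, 23], 1, [5, 13, 17]),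
   (116, [2, 29], 1, [5, 4, 29, 8]),
   (117, [3, 13], 1, [3, 9, 8]),
   (118, [2, 59], 2, [3, 5, 8, 9, 7, 13, 32]),
   (119, [7, 17], 1, [3, 7, 8, 5]),
   (120, [2, 3, 5], 1, [3, 4, 7, 8, 9, 13, 5, 17]),
   (122, [2, 61], 3, [8, 3, 11, 32]),
   (123, [3, 41], 1, [3, 5, 9, 7]),
   (124, [2, 31], 1, [31]),
   (126, [2, 3, 7], 4, [3, 8, 16, 7, 9, 13, 5, 32, 19]),
   (129, [3, 43], 1, [3, 11, 8, 7, 13]),
   (130, [2, 5, 13], 3, [8, 3, 16, 13, 7]),
   (132, [2, 3, 11], 2, [4, 3, 7, 19, 37, 8, 13]),
   (133, [7, 19], 1, [19, 7, 8]),
   (134, [2, 67], 1, [11, 31, 8, 7, 67]),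
   (135, [3, 5], 1, [3, 5, 8]),
   (136, [2, 17], 1, [17]),
   (138, [2, 3, 23], 3, [3, 8, 11, 31, 61, 64])]"

definition certificates_4 :: "(int \<times> int list \<times> int \<times> int list) list" where
  "certificates_4 =
  [(140, [2, 5, 7], 2, [4, 7, 8, 3, 19]),
   (141, [3, 47], 1, [13, 5, 3, 8]),
   (142, [2, 71], 3, [5, 16, 9, 3]),
   (143, [11, 13], 1, [11, 7, 31]),
   (144, [2, 3], 1, [3, 7]),
   (145, [5, 29], 1, [5, 3, 7]),
   (146, [2, 73], 2, [3, 5, 8, 16]),
   (147, [3, 7], 1, [3, 7, 8, 9]),
   (148, [2, 37], 1, [3, 4, 37]),
   (150, [2, 3, 5], 5, [3, 8, 9, 16, 5, 32, 13, 7, 27, 19, 37]),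
   (152, [2, 19], 1, [3, 4, 19, 27]),
   (153, [3, 17], 1, [3, 8, 17]),
   (154, [2, 7, 11], 1, [7, 9, 11, 32]),
   (155, [5, 31], 1, [5]),
   (156, [2, 3, 13], 1, [3, 4, 7, 13, 5, 8]),
   (158, [2, 79], 4, [16, 43]),
   (159, [3, 53], 1, [3, 13, 7, 37]),
   (160, [2, 5], 1, [5, 8]),
   (161, [7, 23], 1, [7]),
   (162, [2, 3], 1, [3, 7]),
   (164, [2, 41], 1, [41]),
   (165, [3, 5, 11], 1, [3, 5, 8, 11]),
   (168, [2, 3, 7], 2, [4, 3, 7, 8, 19, 37, 13, 17])]"

definition certificates_5 :: "(int \<times> int list \<times> int \<times> int list) list" where
  "certificates_5 =
  [(170, [2, 5, 17], 3, [8, 13, 5, 17, 7]),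
   (171, [3, 19], 1, [3, 9, 5, 13]),
   (172, [2, 43], 1, [43]),
   (174, [2, 3, 29], 1, [3, 7, 13, 8, 19, 17, 29, 16]),
   (175, [5, 7], 1, [3, 7]),
   (176, [2, 11], 1, [5, 4, 11]),
   (177, [3, 59], 1, [3, 41, 5]),
   (178, [2, 89], 2, [3, 8, 5, 16, 11]),
   (180, [2, 3, 5], 1, [3, 4, 5, 8, 13, 7, 9, 16, 31, 11]),
   (182, [2, 7, 13], 4, [7, 16, 13, 9, 19, 27]),
   (183, [3, 61], 1, [3, 5, 8, 13, 27]),
   (184, [2, 23], 1, [23, 16]),
   (185, [5, 37], 1, [5, 13]),
   (186, [2, 3, 31], 1, [3, 5, 8, 9, 13, 37, 31]),
   (187, [11, 17], 1, [8, 17, 3, 5]),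
   (188, [2, 47], 2, [4, 11, 16]),
   (189, [3, 7], 1, [3, 9, 7, 8, 5]),
   (190, [2, 5, 19], 2, [5, 8, 9, 7, 13]),
   (192, [2, 3], 3, [3, 4, 8, 7, 13]),
   (194, [2, 97], 2, [3, 7, 16, 8]),
   (195, [3, 5, 13], 1, [3, 9, 13, 7, 8, 5, 32, 17]),
   (196, [2, 7], 1, [7]),
   (198, [2, 3, 11], 1, [3, 7, 9, 19, 11, 8]),
   (200, [2, 5], 1, [5, 8]),
   (216, [2, 3], 1, [3, 4, 7, 13]),
   (220, [2, 5, 11], 1, [5, 8, 11]),
   (224, [2, 7], 1, [7]),
   (225, [3, 5], 1, [3, 5, 8]),
   (231, [3, 7, 11], 1, [3, 9, 5, 8, 7, 13, 19]),
   (240, [2, 3, 5], 2, [4, 3, 5, 8, 13, 7, 16])]"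

definition certificates_6 :: "(int \<times> int list \<times> int \<times> int list) list" where
  "certificates_6 =
  [(242, [2, 11], 1, [11, 5, 61]),
   (245, [5, 7], 1, [3, 7, 5, 8]),
   (250, [2, 5], 1, [5, 8, 3, 13]),
   (252, [2, 3, 7], 2, [3, 4, 7, 8, 19, 27]),
   (264, [2, 3, 11], 2, [4, 3, 11, 61, 8, 9]),
   (270, [2, 3, 5], 4, [3, 8, 5, 16, 7, 13]),
   (275, [5, 11], 1, [5]),
   (280, [2, 5, 7], 2, [4, 7, 9, 8, 13]),
   (288, [2, 3], 1, [3, 7]),
   (294, [2, 3, 7], 1, [3, 7, 9, 19, 37, 73]),
   (297, [3, 11], 1, [3, 5, 8, 11, 7, 19]),
   (300, [2, 3, 5], 1, [3, 4, 13, 7, 5, 16]),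
   (308, [2, 7, 11], 1, [7, 4, 19, 11]),
   (315, [3, 5, 7], 1, [3, 5, 8, 7, 13]),
   (320, [2, 5], 1, [5, 8]),
   (324, [2, 3], 1, [3, 7]),
   (336, [2, 3, 7], 2, [3, 4, 7, 8, 5, 13, 32])]"

definition certificates_7 :: "(int \<times> int list \<times> int \<times> int list) list" where
  "certificates_7 =
  [(350, [2, 5, 7], 3, [8, 7, 9, 19, 27, 37]),
   (352, [2, 11], 1, [11, 4, 3, 5, 9, 7]),
   (360, [2, 3, 5], 1, [3, 4, 5, 8, 31]),
   (363, [3, 11], 1, [3, 11, 7, 181]),
   (375, [3, 5], 1, [3, 5, 8, 11, 41]),
   (378, [2, 3, 7], 3, [3, 8, 7, 13, 9, 5, 19]),
   (384, [2, 3], 2, [4, 3, 9, 7, 8, 13, 5, 16]),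
   (385, [5, 7, 11], 1, [5, 8, 3, 16, 7, 13]),
   (392, [2, 7], 1, [7]),
   (396, [2, 3, 11], 1, [3, 4, 7, 5, 8, 11]),
   (400, [2, 5], 1, [5, 8]),
   (405, [3, 5], 1, [3, 5, 8]),
   (432, [2, 3], 2, [3, 4, 7, 13, 9]),
   (440, [2, 5, 11], 1, [5, 8, 11]),
   (441, [3, 7], 1, [3, 9, 7, 5, 8]),
   (448, [2, 7], 1, [7]),
   (450, [2, 3, 5], 1, [3, 8, 7, 13, 5, 16, 37]),
   (480, [2, 3, 5], 1, [3, 4, 7, 8, 13, 5, 16, 17]),
   (484, [2, 11], 1, [11, 4, 5]),
   (486, [2, 3], 1, [3, 5, 41]),
   (490, [2, 5, 7], 3, [8, 7, 3, 9, 13, 5, 16]),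
   (495, [3, 5, 11], 1, [3, 5, 8, 11]),
   (500, [2, 5], 1, [5, 8]),
   (504, [2, 3, 7], 2, [3, 4, 7, 8, 13, 73]),
   (525, [3, 5, 7], 1, [3, 5, 8, 7, 13]),
   (528, [2, 3, 11], 3, [4, 3, 9, 16, 8, 5, 17, 11, 7, 13])]"

definition certificates_8 :: "(int \<times> int list \<times> int \<times> int list) list" where
  "certificates_8 =
  [(539, [7, 11], 1, [7]),
   (540, [2, 3, 5], 2, [4, 3, 8, 16, 7, 9, 5]),
   (550, [2, 5, 11], 1, [5, 8, 11, 61, 3]),
   (560, [2, 5, 7], 2, [4, 7, 8, 13, 19]),
   (567, [3, 7], 1, [3, 9, 7, 13]),
   (576, [2, 3], 1, [3, 7]),
   (588, [2, 3, 7], 2, [3, 4, 7, 8, 13, 5, 27]),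
   (594, [2, 3, 11], 1, [3, 8, 7, 19, 37, 11, 16]),
   (600, [2, 3, 5], 2, [4, 3, 5, 8, 13, 7, 9, 37, 73])]"

definition certificates_9 :: "(int \<times> int list \<times> int \<times> int list) list" where
  "certificates_9 =
  [(330, [2, 3, 5, 11], 3, [5, 8, 3, 7, 13, 16, 9, 11, 61, 27, 31, 19])]"

definition certificates_10 :: "(int \<times> int list \<times> int \<times> int list) list" where
  "certificates_10 =
  [(462, [2, 3, 7, 11], 4, [3, 8, 16, 7, 19, 9, 37, 13, 5, 27, 73, 32])]"

definition certificates_11 :: "(int \<times> int list \<times> int \<times> int list) list" where
  "certificates_11 =
  [(420, [2, 3, 5, 7], 2, [4, 3, 7, 8, 9, 13, 5, 16, 27, 19, 37, 109])]"

definition certificates_12 :: "(int \<times> int list \<times> int \<times> int list) list" where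
  "certificates_12 =
  [(210, [2, 3, 5, 7], 3, [3, 8, 7, 19, 9, 13, 5, 73])]"

section \<open>Evaluation of the certificates\<close>

lemma excluded_1: "list_all excluded certificates_1"
  by code_simp

lemma excluded_2: "list_all excluded certificates_2"
  by code_simp

lemma excluded_3: "list_all excluded certificates_3"
  by code_simp

lemma excluded_4: "list_all excluded certificates_4"
  by code_simp

lemma excluded_5: "list_all excluded certificates_5"
  by code_simp

lemma excluded_6: "list_all excluded certificates_6"
  by code_simp

lemma excluded_7: "list_all excluded certificates_7"
  by code_simp

lemma excluded_8: "list_all excluded certificates_8"
  by code_simp

lemma excluded_9: "list_all excluded certificates_9"
  by code_simp

lemma excluded_10: "list_all excluded certificates_10"
  by code_simp

lemma excluded_11: "list_all excluded certificates_11"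
  by code_simp

lemma excluded_12: "list_all excluded certificates_12"
  by code_simp

section \<open>Coverage of the alphabet sizes and the conclusion\<close>

definition certificates :: "(int \<times> int list \<times> int \<times> int list) list" where
  "certificates = certificates_1 @ certificates_2 @ certificates_3 @ certificates_4 @ certificates_5 @ certificates_6 @ certificates_7 @ certificates_8 @ certificates_9 @ certificates_10 @ certificates_11 @ certificates_12"

lemma excluded_all: "list_all excluded certificates"
  unfolding certificates_def list_all_append
  by (intro conjI excluded_1 excluded_2 excluded_3 excluded_4 excluded_5 excluded_6 excluded_7 excluded_8 excluded_9 excluded_10 excluded_11 excluded_12)

text \<open>The prime powers from 7 to 200, followed by those from 201 to 600 whose prime is at most
  11.\<close>

definition prime_exponents :: "(int \<times> nat) list" where
  "prime_exponents =
  [(7, 1), (2, 3), (3, 2), (11, 1), (13, 1), (2, 4), (17, 1), (19, 1), (23, 1), (5, 2), (3, 3), (29,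
   1), (31, 1), (2, 5), (37, 1), (41, 1), (43, 1), (47, 1), (7, 2), (53, 1), (59, 1), (61, 1), (2, 6),
   (67, 1), (71, 1), (73, 1), (79, 1), (3, 4), (83, 1), (89, 1), (97, 1), (101, 1), (103, 1), (107, 1),
   (109, 1), (113, 1), (11, 2), (5, 3), (127, 1), (2, 7), (131, 1), (137, 1), (139, 1), (149, 1), (151,
   1), (157, 1), (163, 1), (167, 1), (13, 2), (173, 1), (179, 1), (181, 1), (191, 1), (193, 1), (197,
   1), (199, 1), (3, 5), (2, 8), (7, 3), (2, 9)]"

lemma prime_exponents: "list_all (\<lambda>(p, k). prime p \<and> 0 < k) prime_exponents"
  by code_simp

text \<open>The last condition says that every prime of \<open>q\<close> occurs in
  \<open>ps\<close>; the exponent 9 suffices because the sizes are below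
  \<open>2 ^ 10\<close>.\<close>

definition prime_support :: "int \<times> int list \<times> int \<times> int list \<Rightarrow> bool" where
  "prime_support = (\<lambda>(q, ps, k, ms). ps \<noteq> [] \<and>
     list_all (\<lambda>p. prime p \<and> p dvd q) ps \<and> q dvd prod_list ps ^ 9)"

lemma prime_support_all: "list_all prime_support certificates"
  by code_simp

text \<open>6 has its own argument; 94 and 166 are listed so that the whole interval up to 200 can
  be checked, and are excluded by the assumptions on \<open>q\<close>.\<close>

definition treated :: "int list" where
  "treated = map fst certificates @ map (\<lambda>(p, k). p ^ k) prime_exponents @ [6, 94, 166]"

lemma treated_le_200: "list_all (\<lambda>q. occurs q treated) [6..200]"
  by code_simp

lemma treated_le_600: "list_all (\<lambda>q. occurs q treated) (filter (\<lambda>q. 2310 ^ 9 mod q = 0) [201..600])"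
  by code_simp

text \<open>2310 is the product of 2, 3, 5, 7 and 11, and below \<open>2 ^ 10\<close> no prime has
  an exponent above 9. The condition on all primes thus becomes one divisibility, which can be
  evaluated for each number.\<close>

lemma smooth_dvd:
  fixes q :: nat
  assumes "0 < q" "q < 2 ^ 10" "\<forall>p. prime p \<and> p dvd q \<longrightarrow> p \<in> {2, 3, 5, 7, 11}"
  shows "q dvd 2310 ^ 9"
proof (rule multiplicity_le_imp_dvd)
  fix p :: nat assume p: "prime p"
  show "multiplicity p q \<le> multiplicity p (2310 ^ 9)"
  proof (cases "p dvd q")
    case False
    then show ?thesis by (simp add: not_dvd_imp_multiplicity_0)
  next
    case True
    then have "p dvd 2310" using assms(3) p by auto
    then have "p ^ 9 dvd 2310 ^ 9" by (rule dvd_power_same)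
    then have "9 \<le> multiplicity p (2310 ^ 9)" using p by (intro multiplicity_geI) auto
    moreover have "multiplicity p q < 10"
    proof -
      have "p ^ multiplicity p q \<le> q" using assms(1) by (intro dvd_imp_le multiplicity_dvd) auto
      moreover have "2 ^ multiplicity p q \<le> p ^ multiplicity p q"
        using prime_ge_2_nat[OF p] by (rule power_mono) simp
      ultimately have "(2::nat) ^ multiplicity p q < 2 ^ 10" using assms(2) by linarith
      then show ?thesis by (rule power_less_imp_less_exp[rotated]) simp
    qed
    ultimately show ?thesis by linarith
  qed
qed (use assms(1) in simp)

lemma certificate_sound:
  fixes x y q :: int
  assumes cert: "(q, ps, k, ms) \<in> set certificates"
    and q: "q \<ge> 1" and xy: "x > 0" "y > 0"
    and M: "q\<^sup>2 * (x * y) * M = 2 * q ^ n" "M dvd q ^ n"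
  shows "\<not> root_pair q x y"
proof -
  have ex: "excluded (q, ps, k, ms)"
    using excluded_all cert unfolding list_all_iff by (rule bspec)
  have "prime_support (q, ps, k, ms)"
    using prime_support_all cert unfolding list_all_iff by (rule bspec)
  then have supp: "ps \<noteq> []" "\<forall>p\<in>set ps. prime p \<and> p dvd q" "q dvd prod_list ps ^ 9"
    unfolding prime_support_def prod.case list_all_iff by blast+
  have in_ps: "r \<in> set ps" if r: "prime r" "r dvd q" for r
  proof -
    have "r dvd prod_list ps ^ 9" using r(2) supp(3) by (rule dvd_trans)
    then have "r dvd prod_list ps" using r(1) prime_dvd_power by blast
    then have "\<exists>p\<in>set ps. r dvd p"
      using prime_dvd_prod_mset_iff[OF r(1), of "mset ps"] by (auto simp: prod_mset_prod_list)
    then show ?thesis using r(1) supp(2) primes_dvd_imp_eq by blast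
  qed
  show ?thesis
  proof (cases "even q")
    case True
    have "r \<in> set ps" if "prime r" "r dvd x * y" for r
    proof -
      have "r dvd 2 * q ^ n" unfolding M(1)[symmetric] using that(2) by (simp add: dvd_mult dvd_mult2)
      then have "r dvd 2 \<or> r dvd q" using that(1) by (auto simp: prime_dvd_mult_iff dest: prime_dvd_power)
      then show ?thesis using in_ps[OF that(1)] True by (auto intro: dvd_trans)
    qed
    then show ?thesis using excluded_even[OF ex q True supp(1,2) xy] by blast
  next
    case False
    \<comment> \<open>\<open>M\<close> divides the odd number \<open>q ^ n\<close>, so the factor 2
      on the right of the counting identity must come from \<open>x * y\<close>.\<close>
    have "odd M" using M(2) False by (metis dvd_trans even_power)
    moreover have "even (q\<^sup>2 * (x * y) * M)" unfolding M(1) by simp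
    ultimately have "even (x * y)" using False by simp
    then obtain z where z: "x * y = 2 * z" by (auto elim: evenE)
    have "q\<^sup>2 * z * M = q ^ n" using M(1) unfolding z by simp
    then have "r dvd q ^ n" if "r dvd z" for r using that by (metis dvd_mult dvd_mult2)
    then have "r \<in> set ps" if "prime r" "r dvd z" for r
      using in_ps[OF that(1)] prime_dvd_power[OF that(1)] that(2) by blast
    then show ?thesis using excluded_odd[OF ex q False _ xy z] supp(2) by blast
  qed
qed

theorem theorem2:
  fixes q :: nat and A :: "'a set"
  assumes "q \<ge> 6"
    and "\<not> primepow q"
    and "(q \<le> 200 \<and> q \<noteq> 94 \<and> q \<noteq> 166) \<or>
         (q \<le> 600 \<and> (\<forall>p. prime p \<and> p dvd q \<longrightarrow> p \<in> {2, 3, 5, 7, 11}))"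
    and "card A = q"
  shows "\<not> (\<exists>n M C. n \<ge> 5 \<and> M \<ge> 2 \<and> perfect_code A 2 n M C)"
proof
  assume "\<exists>n M C. n \<ge> 5 \<and> M \<ge> 2 \<and> perfect_code A 2 n M C"
  then obtain n M C where n: "n \<ge> 5" "M \<ge> 2" and perfect: "perfect_code A 2 n M C" by blast
  have fin: "finite A" using assms(1,4) card_ge_0_finite[of A] by simp
  obtain x y where xy: "x > 0" "y > 0" "root_pair (int q) x y"
    and M: "int q ^ 2 * (x * y) * int M = 2 * int q ^ n"
    using perfect_code_root_pair[OF fin assms(4) _ _ _ perfect] assms(1) n by auto
  have "M dvd q ^ n" using perfect assms(4) unfolding perfect_code_def by (metis dvd_triv_left)
  then have M_dvd: "int M dvd int q ^ n" by (metis of_nat_dvd_iff of_nat_power)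
  \<comment> \<open>The first alternative assumes this; under the second the prime divisors 47 and
    83 are not permitted.\<close>
  have "q \<noteq> 94" "q \<noteq> 166"
  proof -
    have "prime (47 :: nat)" "(47 :: nat) dvd 94" "prime (83 :: nat)" "(83 :: nat) dvd 166" by simp_all
    moreover have "(47 :: nat) \<notin> {2, 3, 5, 7, 11}" "(83 :: nat) \<notin> {2, 3, 5, 7, 11}" by simp_all
    ultimately show "q \<noteq> 94" "q \<noteq> 166" using assms(3) by metis+
  qed
  have "int q \<in> set treated"
  proof (cases "q \<le> 200")
    case True
    with assms(1) have "int q \<in> {6..200}" by simp
    then show ?thesis using treated_le_200 unfolding list_all_iff occurs_iff set_upto by (rule bspec[rotated])
  next
    case False
    then have "q dvd 2310 ^ 9" using assms(3) by (intro smooth_dvd) auto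
    then have "2310 ^ 9 mod int q = 0"
      by (metis dvd_eq_mod_eq_0 of_nat_dvd_iff of_nat_numeral of_nat_power)
    moreover have "int q \<in> {201..600}" using False assms(3) by auto
    ultimately have "int q \<in> {x \<in> {201..600}. 2310 ^ 9 mod x = 0}" by (intro CollectI conjI)
    then show ?thesis
      using treated_le_600 unfolding list_all_iff occurs_iff set_filter set_upto by (rule bspec[rotated])
  qed
  moreover define X Y where "X = fst ` set certificates" "Y = (\<lambda>(p, k). p ^ k) ` set prime_exponents"
  ultimately have "int q \<in> X \<union> (Y \<union> {6, 94, 166})"
    by (simp add: treated_def)
  then consider (cert) "int q \<in> X" | (pow) "int q \<in> Y" | (six) "q = 6"
    using \<open>q \<noteq> 94\<close> \<open>q \<noteq> 166\<close> by auto
  then show False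
  proof cases
    case cert
    then obtain ps k ms where "(int q, ps, k, ms) \<in> set certificates" unfolding X_Y_def by auto
    from certificate_sound[OF this _ xy(1,2) M M_dvd] xy(3) assms(1) show False by simp
  next
    case pow
    then obtain p k where pk: "(p, k) \<in> set prime_exponents" "int q = p ^ k"
      unfolding X_Y_def by auto
    have "prime p \<and> 0 < k"
      using prime_exponents pk(1) unfolding list_all_iff by fast
    then have p: "prime p" "0 < k" by blast+
    have "q = nat (p ^ k)" using pk(2) by (metis nat_int)
    then have "q = nat p ^ k" using prime_ge_0_int[OF p(1)] by (simp add: nat_power_eq)
    moreover have "prime (nat p)" using p(1) prime_int_nat_transfer by blast
    ultimately show False using assms(2) p(2) unfolding primepow_def by blast
  next
    case six
    \<comment> \<open>By the counting identity the primes of \<open>x * y\<close> divide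
      \<open>2 * 6 ^ n\<close>.\<close>
    have "r = 2 \<or> r = 3" if "prime r" "r dvd x * y" for r :: int
    proof -
      have "r dvd int q ^ 2 * (x * y) * int M" using that(2) by (rule dvd_mult2[OF dvd_mult])
      then have "r dvd 2 * 6 ^ n" unfolding M using six by simp
      then have "r dvd 2 \<or> r dvd 6"
        using prime_dvd_mult_iff[OF that(1)] prime_dvd_power[OF that(1)] by blast
      then have "r dvd 2 \<or> r dvd 2 * 3" by simp
      then have "r dvd 2 \<or> r dvd 3" using prime_dvd_mult_iff[OF that(1)] by blast
      then show ?thesis using primes_dvd_imp_eq[OF that(1), of 2] primes_dvd_imp_eq[OF that(1), of 3] by auto
    qed
    then show False using no_root_pair_6 xy(3) six by auto
  qed
qed

end
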